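(* In the setting described in the context, suppose there exists $(z_1,\dots,z_m)\in\boldsymbol{\mathcal H}$ with $-\big(\nabla_1\boldsymbol g_1(z_1,\dots,z_m),\dots,\nabla_m\boldsymbol g_m(z_1,\dots,z_m)\big)\in\partial\boldsymbol f(z_1,\dots,z_m)$, and there exists $\chi\in]0,+\infty[$ such that for all $(x_i),(y_i)\in\boldsymbol{\mathcal H}$, $$\sum_{i=1}^m\langle\nabla_i\boldsymbol g_i(x_1,\dots,x_m)-\nabla_i\boldsymbol g_i(y_1,\dots,y_m),x_i-y_i\rangle\ge\frac1\chi\sum_{i=1}^m\|\nabla_i\boldsymbol g_i(x_1,\dots,x_m)-\nabla_i\boldsymbol g_i(y_1,\dots,y_m)\|^2.$$ Let $\varepsilon\in]0,2/(\chi+1)[$ and let $(\gamma_n)_{n\in\mathbb N}$ be a sequence in $[\varepsilon,(2-\varepsilon)/\chi]$. For every $i$, let $x_{i,0}\in\mathcal H_i$ and let $(a_{i,n})_n,(b_{i,n})_n$ be absolutely summable sequences in $\mathcal H_i$. For every $n$ define $y_{i,n}=x_{i,n}-\gamma_n(\nabla_i\boldsymbol g_i(x_{1,n},\dots,x_{m,n})+a_{i,n})$ for $i=1,\dots,m$, and $(x_{1,n+1},\dots,x_{m,n+1})=\operatorname{prox}_{\gamma_n\boldsymbol f}(y_{1,n},\dots,y_{m,n})+(b_{1,n},\dots,b_{m,n})$. Then there exists a solution $(\overline x_1,\dots,\overline x_m)$ to Problem (P) such that for every $i$, $x_{i,n}\rightharpoonup\overline x_i$ and $\nabla_i\boldsymbol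 g_i(x_{1,n},\dots,x_{m,n})\to\nabla_i\boldsymbol g_i(\overline x_1,\dots,\overline x_m)$ strongly.
   Context: Let $m\ge2$ be an integer and let $\mathcal H_1,\dots,\mathcal H_m$ be real Hilbert spaces. Let $\boldsymbol{\mathcal H}=\mathcal H_1\oplus\cdots\oplus\mathcal H_m$ with inner product $\sum_i\langle x_i,y_i\rangle$. $\Gamma_0(\mathcal K)$ denotes the proper lower semicontinuous convex functions $\mathcal K\to\left]-\infty,+\infty\right]$. Let $\boldsymbol f\in\Gamma_0(\boldsymbol{\mathcal H})$ with subdifferential $\partial\boldsymbol f$. For each $i$, $\boldsymbol g_i:\boldsymbol{\mathcal H}\to\left]-\infty,+\infty\right]$ is such that for every $(x_1,\dots,x_m)$, $x\mapsto\boldsymbol g_i(x_1,\dots,x_{i-1},x,x_{i+1},\dots,x_m)$ is convex and differentiable on $\mathcal H_i$, with gradient $\nabla_i\boldsymbol g_i(x_1,\dots,x_m)$ at $x_i$; and $\sum_i\langle\nabla_i\boldsymbol g_i(\boldsymbol x)-\nabla_i\boldsymbol g_i(\boldsymbol y),x_i-y_i\rangle\ge0$ for all $\boldsymbol x,\boldsymbol y\in\boldsymbol{\mathcal H}$. Problem (P): find $x_1\in\mathcal H_1,\dots,x_m\in\mathcal H_m$ such that for each $i$, $x_i\in\operatorname{Argmin}_{x\in\mathcal H_i}\big(\boldsymbol f(x_1,\dots,x_{i-1},x,x_{i+1},\dots,x_m)+\boldsymbol g_i(x_1,\dots,x_{i-1},x,x_{i+1},\dots,x_m)\big)$. For $\varphi\in\Gamma_0(\mathcal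 K)$, $\operatorname{prox}_\varphi x=\operatorname{argmin}_{y}\big(\varphi(y)+\tfrac12\|x-y\|^2\big)$. $\rightharpoonup$ denotes weak convergence, $\to$ strong convergence. *)

theory Defs
  imports "HOL-Analysis.Analysis"
begin

text \<open>The Hilbert spaces H_1,...,H_m are modelled as closed linear subspaces V 0, ..., V (m-1)
of one ambient real Hilbert space 'a. An element of the direct sum H = H_1 + ... + H_m is a
function x :: nat => 'a with x i in V i for i < m and x i = 0 for i >= m.\<close>

definition prodH :: "nat \<Rightarrow> (nat \<Rightarrow> 'a::real_vector set) \<Rightarrow> (nat \<Rightarrow> 'a) set" where
  "prodH m V = {x. (\<forall>i<m. x i \<in> V i) \<and> (\<forall>i. m \<le> i \<longrightarrow> x i = 0)}"

definition pinner :: "nat \<Rightarrow> (nat \<Rightarrow> 'a::real_inner) \<Rightarrow> (nat \<Rightarrow> 'a) \<Rightarrow> real" where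
  "pinner m x y = (\<Sum>i<m. inner (x i) (y i))"

definition pnorm :: "nat \<Rightarrow> (nat \<Rightarrow> 'a::real_inner) \<Rightarrow> real" where
  "pnorm m x = sqrt (pinner m x x)"

definition psub :: "(nat \<Rightarrow> 'a::real_vector) \<Rightarrow> (nat \<Rightarrow> 'a) \<Rightarrow> (nat \<Rightarrow> 'a)" where
  "psub x y = (\<lambda>i. x i - y i)"

definition proper_on :: "'b set \<Rightarrow> ('b \<Rightarrow> ereal) \<Rightarrow> bool" where
  "proper_on C f \<longleftrightarrow> (\<forall>x\<in>C. f x \<noteq> -\<infinity>) \<and> (\<exists>x\<in>C. f x \<noteq> \<infinity>)"

definition convex_ereal_on :: "(nat \<Rightarrow> 'a::real_vector) set \<Rightarrow> ((nat \<Rightarrow> 'a) \<Rightarrow> ereal) \<Rightarrow> bool" where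
  "convex_ereal_on C f \<longleftrightarrow> (\<forall>x\<in>C. \<forall>y\<in>C. \<forall>t::real. 0 < t \<and> t < 1 \<longrightarrow>
       f (\<lambda>i. t *\<^sub>R x i + (1 - t) *\<^sub>R y i) \<le> ereal t * f x + ereal (1 - t) * f y)"

text \<open>Sequential lower semicontinuity w.r.t. the norm topology of the direct sum
(norm convergence in H is componentwise norm convergence).\<close>
definition lsc_prod :: "nat \<Rightarrow> (nat \<Rightarrow> 'a::real_normed_vector set) \<Rightarrow> ((nat \<Rightarrow> 'a) \<Rightarrow> ereal) \<Rightarrow> bool" where
  "lsc_prod m V f \<longleftrightarrow> (\<forall>s x. (\<forall>n. s n \<in> prodH m V) \<and> x \<in> prodH m V \<and>
       (\<forall>i<m. (\<lambda>n. s n i) \<longlonglongrightarrow> x i) \<longrightarrow> f x \<le> liminf (\<lambda>n. f (s n)))"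

definition Gamma0_prod :: "nat \<Rightarrow> (nat \<Rightarrow> 'a::real_normed_vector set) \<Rightarrow> ((nat \<Rightarrow> 'a) \<Rightarrow> ereal) \<Rightarrow> bool" where
  "Gamma0_prod m V f \<longleftrightarrow> proper_on (prodH m V) f \<and> convex_ereal_on (prodH m V) f \<and> lsc_prod m V f"

definition subdiff_prod :: "nat \<Rightarrow> (nat \<Rightarrow> 'a::real_inner set) \<Rightarrow> ((nat \<Rightarrow> 'a) \<Rightarrow> ereal) \<Rightarrow> (nat \<Rightarrow> 'a) \<Rightarrow> (nat \<Rightarrow> 'a) set" where
  "subdiff_prod m V f x = {u \<in> prodH m V. x \<in> prodH m V \<and> \<bar>f x\<bar> \<noteq> \<infinity> \<and>
       (\<forall>y\<in>prodH m V. f x + ereal (pinner m u (psub y x)) \<le> f y)}"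

definition prox_prod :: "nat \<Rightarrow> (nat \<Rightarrow> 'a::real_inner set) \<Rightarrow> ((nat \<Rightarrow> 'a) \<Rightarrow> ereal) \<Rightarrow> (nat \<Rightarrow> 'a) \<Rightarrow> (nat \<Rightarrow> 'a)" where
  "prox_prod m V phi x = (THE p. p \<in> prodH m V \<and>
       (\<forall>q\<in>prodH m V. phi p + ereal ((pnorm m (psub x p))\<^sup>2 / 2) \<le> phi q + ereal ((pnorm m (psub x q))\<^sup>2 / 2)))"

definition weak_conv :: "(nat \<Rightarrow> 'a::real_inner) \<Rightarrow> 'a \<Rightarrow> bool" where
  "weak_conv s l \<longleftrightarrow> (\<forall>y. (\<lambda>n. inner (s n) y) \<longlonglongrightarrow> inner l y)"

definition Grad :: "nat \<Rightarrow> (nat \<Rightarrow> (nat \<Rightarrow> 'a) \<Rightarrow> 'a::zero) \<Rightarrow> (nat \<Rightarrow> 'a) \<Rightarrow> (nat \<Rightarrow> 'a)" where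
  "Grad m grad x = (\<lambda>i. if i < m then grad i x else 0)"

definition solves_P :: "nat \<Rightarrow> (nat \<Rightarrow> 'a::real_vector set) \<Rightarrow> ((nat \<Rightarrow> 'a) \<Rightarrow> ereal) \<Rightarrow> (nat \<Rightarrow> (nat \<Rightarrow> 'a) \<Rightarrow> real) \<Rightarrow> (nat \<Rightarrow> 'a) \<Rightarrow> bool" where
  "solves_P m V f g x \<longleftrightarrow> x \<in> prodH m V \<and>
     (\<forall>i<m. \<forall>t\<in>V i. f x + ereal (g i x) \<le> f (x(i := t)) + ereal (g i (x(i := t))))"

end

theory Submission
  imports Defs
begin

text \<open>The iteration is an inexact forward-backward step for a zero of \<open>\<partial>f + B\<close>, where \<open>B\<close> collects the
  partial gradients. Cocoercivity of \<open>B\<close> and firm nonexpansiveness of the proximal map give, for every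
  zero \<open>z\<close> and up to summable errors, a decrease of \<open>\<parallel>x\<^sub>n - z\<parallel>\<^sup>2\<close> by multiples of
  \<open>\<parallel>B x\<^sub>n - B z\<parallel>\<^sup>2\<close> and of the squared residual; hence \<open>B x\<^sub>n \<rightarrow> B z\<close> and \<open>\<parallel>x\<^sub>n - z\<parallel>\<close> converges.
  A weak cluster point \<open>v\<close> satisfies \<open>B v = B z\<close> by cocoercivity, and it is a zero by Minty's trick:
  monotonicity against the resolvent of \<open>v - B z\<close> forces that resolvent to be \<open>v\<close>, so weak lower
  semicontinuity of \<open>f\<close> is never needed. Opial's argument then yields weak convergence.\<close>

section \<open>Resolvents, projections and the Riesz representation\<close>

lemma power2_norm_diff_scaleR:
  fixes u v :: "'a::real_inner"
  shows "(norm (u - t *\<^sub>R v))\<^sup>2 = (norm u)\<^sup>2 - 2 * t * inner u v + t\<^sup>2 * (norm v)\<^sup>2"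
  unfolding power2_norm_eq_inner
  by (simp add: inner_diff_left inner_diff_right inner_commute algebra_simps power2_eq_square)

text \<open>For \<open>D \<subseteq> S\<close>: the epigraph of \<open>F\<close>, extended by \<open>\<infinity>\<close> outside \<open>D\<close>, is closed in \<open>S \<times> \<real>\<close>.\<close>

definition closed_fun_on :: "'b::real_normed_vector set \<Rightarrow> 'b set \<Rightarrow> ('b \<Rightarrow> real) \<Rightarrow> bool" where
  "closed_fun_on S D F \<longleftrightarrow> (\<forall>s x c. (\<forall>n. s n \<in> D) \<and> x \<in> S \<and> s \<longlonglongrightarrow> x \<and> (\<lambda>n. F (s n)) \<longlonglongrightarrow> c
     \<longrightarrow> x \<in> D \<and> F x \<le> c)"

lemma closed_fun_onI:
  assumes "\<And>s x c. (\<And>n. s n \<in> D) \<Longrightarrow> x \<in> S \<Longrightarrow> s \<longlonglongrightarrow> x \<Longrightarrow> (\<lambda>n. F (s n)) \<longlonglongrightarrow> c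
    \<Longrightarrow> x \<in> D \<and> F x \<le> c"
  shows "closed_fun_on S D F"
  unfolding closed_fun_on_def using assms by blast

lemma closed_fun_onD:
  assumes "closed_fun_on S D F" "\<And>n. s n \<in> D" "x \<in> S" "s \<longlonglongrightarrow> x" "(\<lambda>n. F (s n)) \<longlonglongrightarrow> c"
  shows "x \<in> D" "F x \<le> c"
  using assms unfolding closed_fun_on_def by blast+

text \<open>A lower bound linear in the norm suffices, so that one minimisation covers the proximal
  step, orthogonal projection and the Riesz representation theorem at once.\<close>

lemma resolvent_exists:
  fixes S D :: "'b::real_inner set" and F :: "'b \<Rightarrow> real"
  assumes S: "complete S" "D \<subseteq> S" and D: "D \<noteq> {}" and conv: "convex_on D F"
    and clos: "closed_fun_on S D F"
    and lower: "\<And>q. q \<in> D \<Longrightarrow> d - M * norm q \<le> F q"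
    and r: "r > 0"
  shows "\<exists>p\<in>D. \<forall>q\<in>D. F p + inner ((1/r) *\<^sub>R (y - p)) (q - p) \<le> F q"
proof -
  \<comment> \<open>With this weight, \<open>J\<close> is the proximal objective: stationarity of
    \<open>J\<close> at a minimiser \<open>p\<close> says exactly that
    \<open>(1/r) *\<^sub>R (y - p)\<close> is a subgradient of \<open>F\<close> at
    \<open>p\<close>.\<close>
  define k where "k = 1 / (2 * r)"
  have k: "k > 0" using r by (simp add: k_def)
  define J where "J q = F q + k * (norm (y - q))\<^sup>2" for q
  \<comment> \<open>The quadratic term absorbs the linear lower bound on \<open>F\<close>; the
    constant comes from completing the square in \<open>norm (y - q)\<close>.\<close>
  have below: "d - \<bar>M\<bar> * norm y - M\<^sup>2 / (4 * k) \<le> J q" if "q \<in> D" for q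
  proof -
    have "norm q \<le> norm y + norm (y - q)"
      using norm_triangle_ineq4[of y "y - q"] by simp
    then have "\<bar>M\<bar> * norm q \<le> \<bar>M\<bar> * (norm y + norm (y - q))"
      by (rule mult_left_mono) simp
    moreover have "M * norm q \<le> \<bar>M\<bar> * norm q"
      by (rule mult_right_mono) auto
    moreover have "0 \<le> k * (norm (y - q) - \<bar>M\<bar> / (2 * k))\<^sup>2" using k by simp
    moreover have "k * (norm (y - q) - \<bar>M\<bar> / (2 * k))\<^sup>2
        = k * (norm (y - q))\<^sup>2 - \<bar>M\<bar> * norm (y - q) + M\<^sup>2 / (4 * k)"
      using k by (simp add: power2_diff power_divide field_simps power2_eq_square)
    ultimately show ?thesis using lower[OF that] by (simp add: J_def algebra_simps)
  qed
  define mu where "mu = Inf (J ` D)"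
  have bdd: "bdd_below (J ` D)" using below by (auto simp: bdd_below_def)
  have mu_le: "mu \<le> J q" if "q \<in> D" for q
    unfolding mu_def by (rule cInf_lower) (use that bdd in auto)
  have "\<exists>q\<in>D. J q < mu + 1 / real (Suc n)" for n
    using cInf_lessD[of "J ` D" "mu + 1 / real (Suc n)"] D by (auto simp: mu_def)
  then obtain s where s: "\<And>n. s n \<in> D" "\<And>n. J (s n) < mu + 1 / real (Suc n)" by metis
  have cvx: "convex D" using conv by (simp add: convex_on_def)
  \<comment> \<open>Strong convexity of \<open>J\<close> through the parallelogram law: the midpoint
    of two almost-minimisers still has value at least \<open>mu\<close>, so the two must be close.
    This makes minimising sequences Cauchy.\<close>
  have mid: "k * (norm (u - v))\<^sup>2 \<le> 2 * (J u + J v) - 4 * mu" if "u \<in> D" "v \<in> D" for u v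
  proof -
    define w where "w = (1/2) *\<^sub>R u + (1/2) *\<^sub>R v"
    have w: "w \<in> D" using cvx that unfolding w_def convex_def by (metis field_sum_of_halves zero_le_divide_1_iff zero_le_numeral)
    have "F w \<le> 1/2 * F u + 1/2 * F v"
      unfolding w_def using conv that convex_onD[of D F "1/2" u v] by simp
    moreover have "(norm (y - w))\<^sup>2 = (norm (y - u))\<^sup>2 / 2 + (norm (y - v))\<^sup>2 / 2 - (norm (u - v))\<^sup>2 / 4"
      unfolding w_def power2_norm_eq_inner by (simp add: inner_diff_left inner_diff_right inner_add_left inner_add_right inner_commute field_simps)
    then have "k * (norm (y - w))\<^sup>2 = k * (norm (y - u))\<^sup>2 / 2 + k * (norm (y - v))\<^sup>2 / 2 - k / 4 * (norm (u - v))\<^sup>2"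
      by (simp only:) (simp add: algebra_simps)
    ultimately show ?thesis using mu_le[OF w] unfolding J_def by (simp add: field_simps)
  qed
  have inv0: "(\<lambda>n. 1 / real (Suc n)) \<longlonglongrightarrow> 0" by (rule LIMSEQ_Suc[OF lim_1_over_n])
  have "Cauchy s"
  proof (rule metric_CauchyI)
    fix e :: real assume e: "e > 0"
    \<comment> \<open>Chosen so that \<open>mid\<close>, with both values below
      \<open>mu + d\<close>, gives
      \<open>k * (norm (s i - s j))\<^sup>2 < 4 * d = k * e\<^sup>2\<close>.\<close>
    define d where "d = k * e\<^sup>2 / 4"
    have "d > 0" using k e by (simp add: d_def)
    with inv0 obtain N where N: "\<And>n. n \<ge> N \<Longrightarrow> 1 / real (Suc n) < d"
      by (metis (no_types, lifting) eventually_sequentially order_tendstoD(2))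
    have J_lt: "J (s n) < mu + d" if "n \<ge> N" for n
      using s(2)[of n] N[OF that] by (meson add_strict_left_mono less_trans)
    have "dist (s i) (s j) < e" if "i \<ge> N" "j \<ge> N" for i j
    proof -
      note mid[OF s(1)[of i] s(1)[of j]]
      also have "2 * (J (s i) + J (s j)) - 4 * mu < 4 * d"
        using J_lt[OF that(1)] J_lt[OF that(2)] by argo
      finally have "(norm (s i - s j))\<^sup>2 < e\<^sup>2" using k by (simp add: d_def)
      then show ?thesis using e by (simp add: dist_norm power_less_imp_less_base)
    qed
    then show "\<exists>N. \<forall>i\<ge>N. \<forall>j\<ge>N. dist (s i) (s j) < e" by blast
  qed
  then obtain p where p: "p \<in> S" "s \<longlonglongrightarrow> p"
    using S s(1) unfolding complete_def by (metis subsetD)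
  \<comment> \<open>The quadratic part converges by continuity of the norm, so convergence of
    \<open>J\<close> along \<open>s\<close> makes the values of \<open>F\<close> converge too, as
    closedness of the epigraph requires.\<close>
  have "(\<lambda>n. J (s n)) \<longlonglongrightarrow> mu"
  proof (rule tendsto_sandwich[of "\<lambda>_. mu" _ _ "\<lambda>n. mu + 1 / real (Suc n)"])
    show "(\<lambda>n. mu + 1 / real (Suc n)) \<longlonglongrightarrow> mu" using tendsto_add[OF tendsto_const inv0, of mu] by simp
  qed (use mu_le s in \<open>auto intro!: always_eventually less_imp_le\<close>)
  then have "(\<lambda>n. J (s n) - k * (norm (y - s n))\<^sup>2) \<longlonglongrightarrow> mu - k * (norm (y - p))\<^sup>2"
    by (intro tendsto_intros p)
  then have "(\<lambda>n. F (s n)) \<longlonglongrightarrow> mu - k * (norm (y - p))\<^sup>2" by (simp add: J_def)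
  then have pD: "p \<in> D" and Fp: "F p \<le> mu - k * (norm (y - p))\<^sup>2"
    using closed_fun_onD[OF clos s(1) p] by auto
  have "F p + inner ((1/r) *\<^sub>R (y - p)) (q - p) \<le> F q" if q: "q \<in> D" for q
  proof -
    \<comment> \<open>First-order optimality: compare \<open>p\<close> with the points of the
      segment towards \<open>q\<close>, divide by \<open>t\<close>, and afterwards let
      \<open>t\<close> decrease to 0, which removes the quadratic remainder.\<close>
    have ineq: "F p + 2 * k * inner (y - p) (q - p) - F q \<le> t * (k * (norm (q - p))\<^sup>2)" if t: "0 < t" "t < 1" for t
    proof -
      define w where "w = (1 - t) *\<^sub>R p + t *\<^sub>R q"
      have w: "w \<in> D" using cvx pD q t unfolding w_def by (auto simp: convex_def)
      have Fw: "F w \<le> (1 - t) * F p + t * F q"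
        unfolding w_def using conv pD q t by (intro convex_onD[of D F]) auto
      have yw: "y - w = (y - p) - t *\<^sub>R (q - p)" by (simp add: w_def algebra_simps)
      have "k * (norm (y - w))\<^sup>2 = k * (norm (y - p))\<^sup>2 - t * (2 * k * inner (y - p) (q - p)) + t * (t * (k * (norm (q - p))\<^sup>2))"
        unfolding yw power2_norm_diff_scaleR by (simp add: algebra_simps power2_eq_square)
      then have "t * (F p + 2 * k * inner (y - p) (q - p) - F q) \<le> t * (t * (k * (norm (q - p))\<^sup>2))"
        using mu_le[OF w] Fw Fp unfolding J_def by (simp add: algebra_simps)
      then show ?thesis using t by simp
    qed
    have "F p + 2 * k * inner (y - p) (q - p) - F q \<le> 0"
    proof (rule tendsto_le[OF trivial_limit_at_right_real])
      show "((\<lambda>t. t * (k * (norm (q - p))\<^sup>2)) \<longlongrightarrow> 0) (at_right (0::real))"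
        by (rule tendsto_mult_left_zero) (rule tendsto_ident_at)
      show "((\<lambda>t. F p + 2 * k * inner (y - p) (q - p) - F q) \<longlongrightarrow> F p + 2 * k * inner (y - p) (q - p) - F q) (at_right (0::real))"
        by simp
      show "\<forall>\<^sub>F t in at_right 0. F p + 2 * k * inner (y - p) (q - p) - F q \<le> t * (k * (norm (q - p))\<^sup>2)"
        unfolding eventually_at_right_field by (rule exI[of _ 1]) (use ineq in auto)
    qed
    then show ?thesis using r by (simp add: k_def)
  qed
  then show ?thesis using pD by blast
qed

text \<open>The resolvent of the zero function on \<open>S\<close> is the nearest point
  \<open>p\<close>. Testing its variational inequality at \<open>p + q\<close> and at
  \<open>p - q\<close> turns it into orthogonality.\<close>

lemma complete_subspace_projection:
  fixes S :: "'b::real_inner set"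
  assumes "complete S" "subspace S"
  obtains p where "p \<in> S" "\<And>q. q \<in> S \<Longrightarrow> inner (y - p) q = 0"
proof -
  have "\<exists>p\<in>S. \<forall>q\<in>S. (0::real) + inner ((1/1) *\<^sub>R (y - p)) (q - p) \<le> 0"
  proof (rule resolvent_exists[where S = S and d = 0 and M = 0])
    show "convex_on S (\<lambda>_. 0::real)" using assms(2) by (simp add: convex_on_def subspace_imp_convex)
    show "S \<noteq> {}" using assms(2) subspace_0 by blast
    show "closed_fun_on S S (\<lambda>_. 0::real)"
      by (rule closed_fun_onI) (auto dest: LIMSEQ_unique[OF tendsto_const])
  qed (use assms in auto)
  then obtain p where p: "p \<in> S" "\<And>q. q \<in> S \<Longrightarrow> inner (y - p) (q - p) \<le> 0" by auto
  have "inner (y - p) q = 0" if "q \<in> S" for q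
    using p(2)[of "p + q"] p(2)[of "p - q"] assms(2) that p(1)
    by (auto simp: subspace_add subspace_diff)
  with p(1) show ?thesis using that by blast
qed

text \<open>Minimise \<open>l\<close> plus half the squared norm, that is, take the resolvent of
  \<open>l\<close> at 0. At the minimiser \<open>p\<close> the vector \<open>- p\<close> is a
  subgradient of \<open>l\<close>, and a subgradient of a linear functional represents it. The bound
  on \<open>l\<close> supplies both closedness and the lower estimate.\<close>

lemma riesz_representation_subspace:
  fixes S :: "'b::real_inner set" and l :: "'b \<Rightarrow> real"
  assumes S: "complete S" "subspace S"
    and add: "\<And>u v. u \<in> S \<Longrightarrow> v \<in> S \<Longrightarrow> l (u + v) = l u + l v"
    and scale: "\<And>c u. u \<in> S \<Longrightarrow> l (c *\<^sub>R u) = c * l u"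
    and bound: "\<And>u. u \<in> S \<Longrightarrow> \<bar>l u\<bar> \<le> M * norm u"
  obtains x where "x \<in> S" "\<And>u. u \<in> S \<Longrightarrow> l u = inner x u"
proof -
  have minus: "l (u - v) = l u - l v" if "u \<in> S" "v \<in> S" for u v
    using add[of u "- v"] scale[of v "-1"] that S(2) by (simp add: subspace_neg)
  have "\<exists>p\<in>S. \<forall>q\<in>S. l p + inner ((1/1) *\<^sub>R (0 - p)) (q - p) \<le> l q"
  proof (rule resolvent_exists[where S = S and d = 0 and M = M])
    show "convex_on S l"
      using S(2) by (auto simp: convex_on_def subspace_imp_convex add scale subspace_scale)
    show "S \<noteq> {}" using S(2) subspace_0 by blast
    show "closed_fun_on S S l"
    proof (rule closed_fun_onI)
      fix s x c assume s: "\<And>n. s n \<in> S" "x \<in> S" "s \<longlonglongrightarrow> x" "(\<lambda>n. l (s n)) \<longlonglongrightarrow> c"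
      have "(\<lambda>n. M * norm (s n - x)) \<longlonglongrightarrow> M * norm (x - x)" by (intro tendsto_intros s)
      then have lim0: "(\<lambda>n. M * norm (s n - x)) \<longlonglongrightarrow> 0" by simp
      have "norm (l (s n) - l x) \<le> M * norm (s n - x)" for n
        using bound[of "s n - x"] minus[of "s n" x] s(1)[of n] s(2) S(2) by (simp add: subspace_diff)
      then have "(\<lambda>n. l (s n) - l x) \<longlonglongrightarrow> 0"
        by (intro Lim_null_comparison[OF _ lim0] always_eventually allI)
      then have "(\<lambda>n. l (s n)) \<longlonglongrightarrow> l x" by (rule LIM_zero_cancel)
      from LIMSEQ_unique[OF this s(4)] show "x \<in> S \<and> l x \<le> c" using s(2) by simp
    qed
  next
    fix q assume "q \<in> S" then show "0 - M * norm q \<le> l q" using bound[of q] by auto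
  qed (use S in auto)
  then obtain p where p: "p \<in> S" "\<And>q. q \<in> S \<Longrightarrow> l p - inner p (q - p) \<le> l q" by auto
  have "l u = inner (- p) u" if "u \<in> S" for u
    using p(2)[of "p + u"] p(2)[of "p - u"] S(2) that p(1)
    by (auto simp: subspace_add subspace_diff add minus)
  with p(1) S(2) show ?thesis using that by (meson subspace_neg)
qed

section \<open>Weak cluster points and Opial's lemma\<close>

text \<open>Tychonoff replaces the diagonal argument: cluster points are taken along filters finer than
  the given one instead of along subsequences.\<close>

lemma bounded_weak_cluster_point:
  fixes X :: "'i \<Rightarrow> 'b::real_inner"
  assumes S: "complete S" "subspace S"
    and X: "\<And>i. X i \<in> S" "\<And>i. norm (X i) \<le> M" and F: "F \<noteq> bot"
  obtains G x where "G \<le> F" "G \<noteq> bot" "x \<in> S"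
    "\<And>w. w \<in> S \<Longrightarrow> ((\<lambda>i. inner (X i) w) \<longlongrightarrow> inner x w) G"
proof -
  \<comment> \<open>Each \<open>X i\<close> is identified with its functional
    \<open>\<phi> i\<close>. These functionals lie in a product of compact intervals, whose topology
    is that of pointwise convergence, so a cluster point \<open>l\<close> exists there.\<close>
  define K where "K = (PiE UNIV (\<lambda>w. {- (M * norm w) .. M * norm w}) :: ('b \<Rightarrow> real) set)"
  define \<phi> where "\<phi> i = (\<lambda>w. inner (X i) w)" for i
  have "compactin (product_topology (\<lambda>_. euclidean) UNIV) K"
    unfolding K_def compactin_PiE by simp
  then have "compact K" by (simp add: euclidean_product_topology)
  have bound: "\<bar>inner (X i) w\<bar> \<le> M * norm w" for i w
    using Cauchy_Schwarz_ineq2[of "X i" w] mult_right_mono[OF X(2)[of i] norm_ge_zero[of w]] by linarith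
  then have "\<phi> i \<in> K" for i
    by (auto simp: K_def \<phi>_def abs_le_iff minus_le_iff)
  then have "eventually (\<lambda>h. h \<in> K) (filtermap \<phi> F)" by (simp add: eventually_filtermap)
  moreover have "filtermap \<phi> F \<noteq> bot" using F by (simp add: filtermap_bot_iff)
  ultimately obtain l where l: "inf (nhds l) (filtermap \<phi> F) \<noteq> bot"
    using \<open>compact K\<close> unfolding compact_filter by blast
  \<comment> \<open>Refining \<open>F\<close> by the preimages of the neighbourhoods of
    \<open>l\<close> forces \<open>\<phi>\<close> to converge to \<open>l\<close>; this filter is
    nontrivial precisely because \<open>l\<close> is a cluster point.\<close>
  define G where "G = inf F (filtercomap \<phi> (nhds l))"
  have GF: "G \<le> F" by (simp add: G_def)
  have Gbot: "G \<noteq> bot"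
  proof
    assume "G = bot"
    then obtain Q R where Q: "eventually Q F" and R: "eventually R (filtercomap \<phi> (nhds l))"
      and QR: "\<And>i. Q i \<Longrightarrow> R i \<Longrightarrow> False"
      unfolding G_def trivial_limit_def eventually_inf by metis
    then obtain R' where R': "eventually R' (nhds l)" "\<And>i. R' (\<phi> i) \<Longrightarrow> R i"
      unfolding eventually_filtercomap by blast
    have "eventually (\<lambda>h. \<not> R' h) (filtermap \<phi> F)"
      unfolding eventually_filtermap using Q by eventually_elim (use QR R' in blast)
    with R'(1) have "eventually (\<lambda>_. False) (inf (nhds l) (filtermap \<phi> F))"
      unfolding eventually_inf by blast
    with l show False by (simp add: trivial_limit_def)
  qed
  have "(\<phi> \<longlongrightarrow> l) G"
    by (rule filterlim_mono[OF filterlim_filtercomap order_refl]) (simp add: G_def)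
  then have lim: "((\<lambda>i. inner (X i) w) \<longlongrightarrow> l w) G" for w
    using continuous_on_tendsto_compose[OF continuous_on_product_coordinates[of w], of \<phi> l G]
    by (simp add: \<phi>_def)
  \<comment> \<open>Linearity and the norm bound pass to the pointwise limit. Completeness is
    available only on \<open>S\<close>, so \<open>l\<close> is represented there and weak limits are
    tested against vectors of \<open>S\<close>.\<close>
  obtain x where x: "x \<in> S" "\<And>u. u \<in> S \<Longrightarrow> l u = inner x u"
  proof (rule riesz_representation_subspace[OF S, of l M])
    show "l (u + v) = l u + l v" for u v
      using lim[of "u + v"] tendsto_add[OF lim[of u] lim[of v]] tendsto_unique[OF Gbot]
      by (simp add: inner_add_right)
    show "l (c *\<^sub>R u) = c * l u" for c u
      using lim[of "c *\<^sub>R u"] tendsto_mult_left[OF lim[of u], of c] tendsto_unique[OF Gbot]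
      by simp
    show "\<bar>l u\<bar> \<le> M * norm u" for u
      by (rule tendsto_upperbound[OF tendsto_rabs[OF lim[of u]] _ Gbot]) (simp add: bound)
  qed blast
  show ?thesis by (rule that[OF GF Gbot x(1)]) (use lim x(2) in metis)
qed

text \<open>For weak cluster points \<open>x\<close> and \<open>x'\<close>, both in
  \<open>Z\<close>, convergence of the two distances makes \<open>inner (X n) (x - x')\<close>
  converge. Its limit equals both \<open>inner x (x - x')\<close> and
  \<open>inner x' (x - x')\<close>, hence \<open>x = x'\<close>; a bounded sequence with a single
  weak cluster point converges weakly.\<close>

lemma opial:
  fixes X :: "nat \<Rightarrow> 'b::real_inner"
  assumes S: "complete S" "subspace S" and X: "\<And>n. X n \<in> S"
    and Z: "Z \<noteq> {}" "\<And>z. z \<in> Z \<Longrightarrow> convergent (\<lambda>n. norm (X n - z))"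
    and cluster: "\<And>G x. G \<le> sequentially \<Longrightarrow> G \<noteq> bot \<Longrightarrow> x \<in> S \<Longrightarrow>
        (\<And>w. w \<in> S \<Longrightarrow> ((\<lambda>n. inner (X n) w) \<longlongrightarrow> inner x w) G) \<Longrightarrow> x \<in> Z"
  shows "\<exists>x\<in>Z \<inter> S. \<forall>w. (\<lambda>n. inner (X n) w) \<longlonglongrightarrow> inner x w"
proof -
  obtain z where "z \<in> Z" using Z(1) by blast
  then obtain M where M: "\<And>n. norm (X n - z) \<le> M"
    using Z(2) convergent_imp_Bseq[of "\<lambda>n. norm (X n - z)"] unfolding Bseq_def by auto
  have bounded: "norm (X n) \<le> M + norm z" for n
    using norm_triangle_ineq[of "X n - z" z] M[of n] by simp
  have unique: "x = x'" if G: "G \<le> sequentially" "G \<noteq> bot" "x \<in> S"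
      "\<And>w. w \<in> S \<Longrightarrow> ((\<lambda>n. inner (X n) w) \<longlongrightarrow> inner x w) G"
    and G': "G' \<le> sequentially" "G' \<noteq> bot" "x' \<in> S"
      "\<And>w. w \<in> S \<Longrightarrow> ((\<lambda>n. inner (X n) w) \<longlongrightarrow> inner x' w) G'" for x x' G G'
  proof -
    have "x \<in> Z" "x' \<in> Z" using cluster G G' by blast+
    then obtain a a' where "(\<lambda>n. norm (X n - x)) \<longlonglongrightarrow> a" "(\<lambda>n. norm (X n - x')) \<longlonglongrightarrow> a'"
      using Z(2) unfolding convergent_def by blast
    then have "(\<lambda>n. ((norm (X n - x'))\<^sup>2 - (norm (X n - x))\<^sup>2 + (norm x)\<^sup>2 - (norm x')\<^sup>2) / 2)
        \<longlonglongrightarrow> (a'\<^sup>2 - a\<^sup>2 + (norm x)\<^sup>2 - (norm x')\<^sup>2) / 2" (is "_ \<longlonglongrightarrow> ?L")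
      by (intro tendsto_intros) auto
    moreover have "((norm (X n - x'))\<^sup>2 - (norm (X n - x))\<^sup>2 + (norm x)\<^sup>2 - (norm x')\<^sup>2) / 2 = inner (X n) (x - x')" for n
      unfolding power2_norm_eq_inner by (simp add: inner_diff_left inner_diff_right inner_commute)
    ultimately have "(\<lambda>n. inner (X n) (x - x')) \<longlonglongrightarrow> ?L" by simp
    then have "((\<lambda>n. inner (X n) (x - x')) \<longlongrightarrow> ?L) G" "((\<lambda>n. inner (X n) (x - x')) \<longlongrightarrow> ?L) G'"
      using G(1) G'(1) tendsto_mono by blast+
    moreover have "x - x' \<in> S" using G(3) G'(3) S(2) by (simp add: subspace_diff)
    ultimately have "inner x (x - x') = ?L" "inner x' (x - x') = ?L"
      using G(2,4) G'(2,4) tendsto_unique by blast+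
    then have "inner (x - x') (x - x') = 0" by (simp add: inner_diff_left)
    then show ?thesis by simp
  qed
  obtain G x where G: "G \<le> sequentially" "G \<noteq> bot" "x \<in> S"
      "\<And>w. w \<in> S \<Longrightarrow> ((\<lambda>n. inner (X n) w) \<longlongrightarrow> inner x w) G"
    by (rule bounded_weak_cluster_point[where X = X, OF S X bounded sequentially_bot]) blast
  have conv: "(\<lambda>n. inner (X n) w) \<longlonglongrightarrow> inner x w" if w: "w \<in> S" for w
  proof (rule ccontr)
    assume "\<not> ?thesis"
    then obtain U where U: "open U" "inner x w \<in> U" "\<not> eventually (\<lambda>n. inner (X n) w \<in> U) sequentially"
      unfolding tendsto_def by blast
    \<comment> \<open>Restricting to the indices whose value avoids \<open>U\<close> leaves a
      nontrivial filter. It has a weak cluster point of its own, which must be \<open>x\<close>,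
      contradicting that the values stay outside \<open>U\<close>.\<close>
    define F where "F = inf sequentially (principal {n. inner (X n) w \<notin> U})"
    have "F \<noteq> bot"
      using U(3) by (simp add: F_def trivial_limit_def eventually_inf_principal)
    obtain G' x' where G': "G' \<le> F" "G' \<noteq> bot" "x' \<in> S"
      "\<And>w. w \<in> S \<Longrightarrow> ((\<lambda>n. inner (X n) w) \<longlongrightarrow> inner x' w) G'"
      by (rule bounded_weak_cluster_point[where X = X, OF S X bounded \<open>F \<noteq> bot\<close>]) blast
    have "G' \<le> sequentially" using G'(1) by (simp add: F_def)
    then have "x' = x" using unique[OF G _ G'(2-4)] by simp
    then have "eventually (\<lambda>n. inner (X n) w \<in> U) G'"
      using G'(4)[OF w] U topological_tendstoD by blast
    moreover have "eventually (\<lambda>n. inner (X n) w \<notin> U) G'"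
      using G'(1) by (rule filter_leD) (simp add: F_def eventually_inf_principal)
    ultimately have "eventually (\<lambda>_. False) G'" by eventually_elim blast
    with G'(2) show False by (simp add: trivial_limit_def)
  qed
  \<comment> \<open>An arbitrary test vector acts on \<open>S\<close> like its orthogonal projection
    onto \<open>S\<close>.\<close>
  have "(\<lambda>n. inner (X n) w) \<longlonglongrightarrow> inner x w" for w
  proof -
    obtain p where p: "p \<in> S" "\<And>q. q \<in> S \<Longrightarrow> inner (w - p) q = 0"
      by (rule complete_subspace_projection[OF S]) blast
    have "inner q w = inner q p" if "q \<in> S" for q
      using p(2)[OF that] by (simp add: inner_diff_left inner_commute[of q])
    then show ?thesis using conv[OF p(1)] X G(3) by simp
  qed
  then show ?thesis using cluster[OF G] G(3) by blast
qed

section \<open>The forward-backward iteration\<close>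

text \<open>\<open>D\<close> plays the role of the effective domain: with \<open>F\<close> taken to
  be infinite outside \<open>D\<close>, the inequality over \<open>D\<close> is the usual
  subgradient inequality.\<close>

definition subgrad_on :: "'b::real_inner set \<Rightarrow> ('b \<Rightarrow> real) \<Rightarrow> 'b \<Rightarrow> 'b \<Rightarrow> bool" where
  "subgrad_on D F x u \<longleftrightarrow> x \<in> D \<and> (\<forall>q\<in>D. F x + inner u (q - x) \<le> F q)"

lemma subgrad_on_monotone:
  assumes "subgrad_on D F x u" "subgrad_on D F y v"
  shows "0 \<le> inner (u - v) (x - y)"
proof -
  have "F x + inner u (y - x) \<le> F y" "F y + inner v (x - y) \<le> F x"
    using assms by (auto simp: subgrad_on_def)
  then show ?thesis by (simp add: inner_diff_left inner_diff_right)
qed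

text \<open>Write \<open>y - y'\<close> as the sum of \<open>(y - p) - (y' - p')\<close> and
  \<open>p - p'\<close>. Monotonicity of subgradients makes the cross term in the expanded square
  nonnegative.\<close>

lemma resolvent_firmly_nonexpansive:
  assumes "r > 0" "subgrad_on D F p ((1/r) *\<^sub>R (y - p))" "subgrad_on D F p' ((1/r) *\<^sub>R (y' - p'))"
  shows "(norm (p - p'))\<^sup>2 \<le> (norm (y - y'))\<^sup>2 - (norm ((y - p) - (y' - p')))\<^sup>2"
proof -
  have "0 \<le> inner ((1/r) *\<^sub>R (y - p) - (1/r) *\<^sub>R (y' - p')) (p - p')"
    by (rule subgrad_on_monotone[OF assms(2,3)])
  also have "\<dots> = (1/r) * inner ((y - p) - (y' - p')) (p - p')"
    by (simp flip: scaleR_diff_right)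
  finally have "0 \<le> inner ((y - p) - (y' - p')) (p - p')"
    using assms(1) by (simp add: zero_le_divide_iff)
  moreover have "(norm (y - y'))\<^sup>2 = (norm ((y - p) - (y' - p')))\<^sup>2 + (norm (p - p'))\<^sup>2
      + 2 * inner ((y - p) - (y' - p')) (p - p')"
    using dot_norm[of "(y - p) - (y' - p')" "p - p'"] by simp
  ultimately show ?thesis by simp
qed

lemma resolvent_nonexpansive:
  assumes "r > 0" "subgrad_on D F p ((1/r) *\<^sub>R (y - p))" "subgrad_on D F p' ((1/r) *\<^sub>R (y' - p'))"
  shows "norm (p - p') \<le> norm (y - y')"
proof (rule power2_le_imp_le)
  show "(norm (p - p'))\<^sup>2 \<le> (norm (y - y'))\<^sup>2"
    using resolvent_firmly_nonexpansive[OF assms] zero_le_power2[of "norm ((y - p) - (y' - p'))"]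
    by linarith
qed simp

text \<open>Subtracting the partial sums of \<open>e\<close> leaves a decreasing sequence bounded
  below by \<open>- suminf e\<close>.\<close>

lemma quasi_decreasing_convergent:
  fixes u e :: "nat \<Rightarrow> real"
  assumes "\<And>n. 0 \<le> u n" "\<And>n. 0 \<le> e n" "summable e" "\<And>n. u (Suc n) \<le> u n + e n"
  shows "convergent u"
proof -
  define v where "v n = u n - (\<Sum>k<n. e k)" for n
  have "decseq v" using assms(4) by (intro decseq_SucI) (simp add: v_def algebra_simps)
  moreover have "- suminf e \<le> v n" for n
    using sum_le_suminf[OF assms(3), of "{..<n}"] assms(1)[of n] assms(2) by (simp add: v_def)
  ultimately obtain L where "v \<longlonglongrightarrow> L" using decseq_convergent by blast
  moreover have "(\<lambda>n. \<Sum>k<n. e k) \<longlonglongrightarrow> suminf e" using assms(3) summable_LIMSEQ by blast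
  ultimately have "(\<lambda>n. v n + (\<Sum>k<n. e k)) \<longlonglongrightarrow> L + suminf e" by (rule tendsto_add)
  then show ?thesis by (auto simp: v_def convergent_def)
qed

text \<open>Replacing \<open>A i\<close> by its strong limit costs at most
  \<open>norm (A i - l) * K\<close> by Cauchy-Schwarz, so weak information on \<open>C\<close> is
  required only against the single vector \<open>l\<close>.\<close>

lemma tendsto_inner_strong_weak:
  fixes A C :: "'i \<Rightarrow> 'b::real_inner"
  assumes "(A \<longlongrightarrow> l) G" "\<And>i. norm (C i) \<le> K" "((\<lambda>i. inner (C i) l) \<longlongrightarrow> c) G"
  shows "((\<lambda>i. inner (A i) (C i)) \<longlongrightarrow> c) G"
proof -
  have "((\<lambda>i. norm (A i - l) * K) \<longlongrightarrow> norm (l - l) * K) G" by (intro tendsto_intros assms)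
  then have lim0: "((\<lambda>i. norm (A i - l) * K) \<longlongrightarrow> 0) G" by simp
  have "norm (inner (A i - l) (C i)) \<le> norm (A i - l) * K" for i
    using Cauchy_Schwarz_ineq2[of "A i - l" "C i"] mult_left_mono[OF assms(2)[of i], of "norm (A i - l)"]
    by simp
  then have "\<forall>\<^sub>F i in G. norm (inner (A i - l) (C i)) \<le> norm (A i - l) * K" by simp
  then have "((\<lambda>i. inner (A i - l) (C i)) \<longlongrightarrow> 0) G" by (rule Lim_null_comparison[OF _ lim0])
  from tendsto_add[OF this assms(3)] show ?thesis
    by (simp add: inner_diff_left inner_commute[of _ l])
qed

text \<open>One subgradient provides an affine minorant of \<open>F\<close>, hence the lower bound
  linear in the norm from which minimisers are obtained.\<close>

lemma resolvent_exists_of_subgrad: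
  fixes S D :: "'b::real_inner set" and F :: "'b \<Rightarrow> real"
  assumes S: "complete S" "D \<subseteq> S" and conv: "convex_on D F"
    and clos: "closed_fun_on S D F"
    and z: "subgrad_on D F z v" and r: "r > 0"
  shows "\<exists>p. subgrad_on D F p ((1/r) *\<^sub>R (y - p))"
proof -
  have "F z - inner v z - norm v * norm q \<le> F q" if "q \<in> D" for q
  proof -
    have "F z + inner v (q - z) \<le> F q" using z that by (simp add: subgrad_on_def)
    then show ?thesis using norm_cauchy_schwarz[of "- v" q] by (simp add: inner_diff_right)
  qed
  then have "\<exists>p\<in>D. \<forall>q\<in>D. F p + inner ((1/r) *\<^sub>R (y - p)) (q - p) \<le> F q"
    using z r by (intro resolvent_exists[OF S _ conv clos]) (auto simp: subgrad_on_def)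
  then show ?thesis by (auto simp: subgrad_on_def)
qed

text \<open>The term with \<open>q - p\<close> is the quadratic growth of the proximal objective
  away from \<open>p\<close>; it gives uniqueness of the minimiser as well as minimality.\<close>

lemma resolvent_minimizes:
  assumes "r > 0" "subgrad_on D F p ((1/r) *\<^sub>R (y - p))" "q \<in> D"
  shows "r * F p + (norm (y - p))\<^sup>2 / 2 + (norm (q - p))\<^sup>2 / 2 \<le> r * F q + (norm (y - q))\<^sup>2 / 2"
proof -
  have "F p + (1/r) * inner (y - p) (q - p) \<le> F q"
    using assms(2,3) by (simp add: subgrad_on_def)
  from mult_left_mono[OF this, of r] have "r * F p + inner (y - p) (q - p) \<le> r * F q"
    using assms(1) by (simp add: distrib_left)
  moreover have "(norm (y - q))\<^sup>2 = (norm (y - p))\<^sup>2 - 2 * inner (y - p) (q - p) + (norm (q - p))\<^sup>2"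
    using power2_norm_diff_scaleR[of "y - p" 1 "q - p"] by simp
  ultimately show ?thesis by argo
qed

theorem forward_backward_weak_convergence:
  fixes S D :: "'b::real_inner set" and F :: "'b \<Rightarrow> real" and B :: "'b \<Rightarrow> 'b"
    and x p a b :: "nat \<Rightarrow> 'b" and \<gamma> :: "nat \<Rightarrow> real"
  assumes S: "complete S" "subspace S" and DS: "D \<subseteq> S" and conv: "convex_on D F"
    and clos: "closed_fun_on S D F"
    and BS: "\<And>u. u \<in> S \<Longrightarrow> B u \<in> S" and chi: "chi > 0"
    and coco: "\<And>u v. u \<in> S \<Longrightarrow> v \<in> S \<Longrightarrow>
        inner (B u - B v) (u - v) \<ge> (1 / chi) * (norm (B u - B v))\<^sup>2"
    and z: "subgrad_on D F z (- B z)"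
    and eps: "eps > 0" and gamma: "\<And>n. eps \<le> \<gamma> n" "\<And>n. \<gamma> n \<le> (2 - eps) / chi"
    and x: "\<And>n. x n \<in> S"
    and sum: "summable (\<lambda>n. norm (a n))" "summable (\<lambda>n. norm (b n))"
    and p: "\<And>n. subgrad_on D F (p n) ((1 / \<gamma> n) *\<^sub>R (x n - \<gamma> n *\<^sub>R (B (x n) + a n) - p n))"
    and step: "\<And>n. x (Suc n) = p n + b n"
  shows "\<exists>xb\<in>S. subgrad_on D F xb (- B xb) \<and> (\<forall>w. (\<lambda>n. inner (x n) w) \<longlonglongrightarrow> inner xb w)
      \<and> (\<lambda>n. B (x n)) \<longlonglongrightarrow> B xb"
proof -
  have zD: "z \<in> D" and zS: "z \<in> S" using z DS by (auto simp: subgrad_on_def)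
  have \<gamma>pos: "\<gamma> n > 0" for n using gamma(1)[of n] eps by linarith
  have \<gamma>le: "\<gamma> n \<le> 2 / chi" for n
    using gamma(2)[of n] eps chi divide_right_mono[of "2 - eps" 2 chi] by linarith
  note res = resolvent_exists_of_subgrad[OF S(1) DS conv clos z]
  \<comment> \<open>\<open>t n\<close> is the error-free step from the same point
    \<open>x n\<close>. The descent estimate is proved for \<open>t n\<close> and transferred to
    \<open>x (Suc n)\<close> at cost \<open>e n\<close>.\<close>
  have "\<forall>n. \<exists>q. subgrad_on D F q ((1 / \<gamma> n) *\<^sub>R (x n - \<gamma> n *\<^sub>R B (x n) - q))"
    using res[OF \<gamma>pos] by blast
  from choice[OF this] obtain t where t: "\<And>n. subgrad_on D F (t n) ((1 / \<gamma> n) *\<^sub>R (x n - \<gamma> n *\<^sub>R B (x n) - t n))"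
    by blast
  have tS: "t n \<in> S" for n using t DS by (auto simp: subgrad_on_def)

  \<comment> \<open>The error \<open>a n\<close> enters scaled by \<open>\<gamma> n\<close>, at most
    \<open>2 / chi\<close>, and is not enlarged by the resolvent; \<open>b n\<close> is added after
    it.\<close>
  define e where "e n = 2 / chi * norm (a n) + norm (b n)" for n
  have e: "summable e" "\<And>n. e n \<ge> 0"
    unfolding e_def using sum chi by (auto intro!: summable_add summable_mult)
  have xt: "norm (x (Suc n) - t n) \<le> e n" for n
  proof -
    have "norm (p n - t n) \<le> norm (x n - \<gamma> n *\<^sub>R (B (x n) + a n) - (x n - \<gamma> n *\<^sub>R B (x n)))"
      by (rule resolvent_nonexpansive[OF \<gamma>pos p t])
    also have "\<dots> = \<gamma> n * norm (a n)"
      using \<gamma>pos[of n] by (simp add: scaleR_add_right)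
    also have "\<dots> \<le> 2 / chi * norm (a n)" by (rule mult_right_mono[OF \<gamma>le]) simp
    finally show ?thesis
      using norm_triangle_ineq[of "p n - t n" "b n"] by (simp add: step e_def algebra_simps)
  qed

  have descent: "(norm (t n - w))\<^sup>2 + eps\<^sup>2 / chi * (norm (B (x n) - B w))\<^sup>2
      + (norm (x n - t n - \<gamma> n *\<^sub>R (B (x n) - B w)))\<^sup>2 \<le> (norm (x n - w))\<^sup>2"
    if w: "subgrad_on D F w (- B w)" for n w
  proof -
    have wS: "w \<in> S" using w DS by (auto simp: subgrad_on_def)
    define d where "d = B (x n) - B w"
    \<comment> \<open>A zero \<open>w\<close> is a fixed point of the exact step for every step
      size, so firm nonexpansiveness can compare \<open>t n\<close> with \<open>w\<close>.\<close>
    have "subgrad_on D F w ((1 / \<gamma> n) *\<^sub>R (w - \<gamma> n *\<^sub>R B w - w))"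
      using w \<gamma>pos[of n] by simp
    from resolvent_firmly_nonexpansive[OF \<gamma>pos t this]
    have "(norm (t n - w))\<^sup>2 \<le> (norm (x n - w - \<gamma> n *\<^sub>R d))\<^sup>2 - (norm (x n - t n - \<gamma> n *\<^sub>R d))\<^sup>2"
      by (simp add: d_def algebra_simps)
    moreover have "(norm (x n - w - \<gamma> n *\<^sub>R d))\<^sup>2 \<le> (norm (x n - w))\<^sup>2 - eps\<^sup>2 / chi * (norm d)\<^sup>2"
    proof -
      have "(1 / chi) * (norm d)\<^sup>2 \<le> inner (x n - w) d"
        using coco[OF x[of n] wS] by (simp add: d_def inner_commute)
      then have "2 * \<gamma> n * ((1 / chi) * (norm d)\<^sup>2) \<le> 2 * \<gamma> n * inner (x n - w) d"
        using \<gamma>pos[of n] by (intro mult_left_mono) auto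
      \<comment> \<open>The two bounds on the step size give \<open>\<gamma> n \<ge> eps\<close> and
        \<open>2 / chi - \<gamma> n \<ge> eps / chi\<close>; their product is the coefficient
        \<open>eps\<^sup>2 / chi\<close> in the descent.\<close>
      moreover have "eps * (eps / chi) \<le> \<gamma> n * (2 / chi - \<gamma> n)"
        using gamma[of n] eps chi by (intro mult_mono) (auto simp: diff_divide_distrib)
      then have "eps * (eps / chi) * (norm d)\<^sup>2 \<le> \<gamma> n * (2 / chi - \<gamma> n) * (norm d)\<^sup>2"
        by (rule mult_right_mono) simp
      ultimately show ?thesis
        unfolding power2_norm_diff_scaleR by (simp add: algebra_simps power2_eq_square)
    qed
    ultimately show ?thesis by (simp add: d_def)
  qed

  have norm_conv: "convergent (\<lambda>n. norm (x n - w))" if w: "subgrad_on D F w (- B w)" for w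
  proof (rule quasi_decreasing_convergent[OF _ e(2,1)])
    fix n
    have "(norm (t n - w))\<^sup>2 \<le> (norm (x n - w))\<^sup>2"
    proof -
      have "0 \<le> eps\<^sup>2 / chi * (norm (B (x n) - B w))\<^sup>2" using chi by simp
      then show ?thesis
        using descent[OF w, of n] zero_le_power2[of "norm (x n - t n - \<gamma> n *\<^sub>R (B (x n) - B w))"]
        by linarith
    qed
    then have "norm (t n - w) \<le> norm (x n - w)" by (rule power2_le_imp_le) simp
    then show "norm (x (Suc n) - w) \<le> norm (x n - w) + e n"
      using xt[of n] norm_triangle_ineq[of "x (Suc n) - t n" "t n - w"] by simp
  qed simp

  obtain L where L: "(\<lambda>n. norm (x n - z)) \<longlonglongrightarrow> L"
    using norm_conv[OF z] by (auto simp: convergent_def)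
  \<comment> \<open>Since \<open>x (Suc n)\<close> and \<open>t n\<close> differ by a null sequence,
    \<open>norm (t n - z)\<close> has the same limit as \<open>norm (x n - z)\<close>. The gap
    between their squares therefore vanishes, and it dominates each remaining term of the
    descent.\<close>
  have "(\<lambda>n. norm (x (Suc n) - z) - norm (t n - z)) \<longlonglongrightarrow> 0"
  proof (rule Lim_null_comparison[OF _ summable_LIMSEQ_zero[OF e(1)]])
    have "norm (norm (x (Suc n) - z) - norm (t n - z)) \<le> e n" for n
      using norm_triangle_ineq3[of "x (Suc n) - z" "t n - z"] xt[of n] by simp
    then show "\<forall>\<^sub>F n in sequentially. norm (norm (x (Suc n) - z) - norm (t n - z)) \<le> e n" by simp
  qed
  from tendsto_diff[OF LIMSEQ_Suc[OF L] this] have "(\<lambda>n. norm (t n - z)) \<longlonglongrightarrow> L" by simp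
  from tendsto_diff[OF tendsto_power[OF L, of 2] tendsto_power[OF this, of 2]]
  have gap: "(\<lambda>n. (norm (x n - z))\<^sup>2 - (norm (t n - z))\<^sup>2) \<longlonglongrightarrow> 0" by simp
  have null_of_square: "v \<longlonglongrightarrow> 0"
    if "k > 0" "\<And>n. k * (norm (v n))\<^sup>2 \<le> (norm (x n - z))\<^sup>2 - (norm (t n - z))\<^sup>2" for v :: "nat \<Rightarrow> 'b" and k
  proof -
    have "(\<lambda>n. k * (norm (v n))\<^sup>2) \<longlonglongrightarrow> 0"
      by (rule tendsto_sandwich[OF _ _ tendsto_const gap]) (use that in auto)
    from tendsto_mult_left[OF this, of "1 / k"] have "(\<lambda>n. (norm (v n))\<^sup>2) \<longlonglongrightarrow> 0"
      using that(1) by simp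
    from tendsto_real_sqrt[OF this] show ?thesis by (simp add: tendsto_norm_zero_iff)
  qed
  have "(\<lambda>n. B (x n) - B z) \<longlonglongrightarrow> 0"
  proof (rule null_of_square)
    show "eps\<^sup>2 / chi > 0" using eps chi by simp
    show "eps\<^sup>2 / chi * (norm (B (x n) - B z))\<^sup>2 \<le> (norm (x n - z))\<^sup>2 - (norm (t n - z))\<^sup>2" for n
      using descent[OF z, of n] zero_le_power2[of "norm (x n - t n - \<gamma> n *\<^sub>R (B (x n) - B z))"] by linarith
  qed
  then have Bx: "(\<lambda>n. B (x n)) \<longlonglongrightarrow> B z" by (rule LIM_zero_cancel)
  have res_lim: "(\<lambda>n. x n - t n) \<longlonglongrightarrow> 0"
  proof -
    have "(\<lambda>n. x n - t n - \<gamma> n *\<^sub>R (B (x n) - B z)) \<longlonglongrightarrow> 0"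
    proof (rule null_of_square)
      fix n
      have "0 \<le> eps\<^sup>2 / chi * (norm (B (x n) - B z))\<^sup>2" using chi by simp
      then show "1 * (norm (x n - t n - \<gamma> n *\<^sub>R (B (x n) - B z)))\<^sup>2
          \<le> (norm (x n - z))\<^sup>2 - (norm (t n - z))\<^sup>2"
        using descent[OF z, of n] by linarith
    qed simp
    \<comment> \<open>Step sizes are bounded above, so the gradient part is null and only the
      residual \<open>x n - t n\<close> remains.\<close>
    moreover have "(\<lambda>n. \<gamma> n *\<^sub>R (B (x n) - B z)) \<longlonglongrightarrow> 0"
    proof (rule Lim_null_comparison)
      have "norm (\<gamma> n *\<^sub>R (B (x n) - B z)) \<le> 2 / chi * norm (B (x n) - B z)" for n
        using mult_right_mono[OF \<gamma>le[of n] norm_ge_zero] \<gamma>pos[of n] by simp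
      then show "\<forall>\<^sub>F n in sequentially. norm (\<gamma> n *\<^sub>R (B (x n) - B z)) \<le> 2 / chi * norm (B (x n) - B z)"
        by simp
      show "(\<lambda>n. 2 / chi * norm (B (x n) - B z)) \<longlonglongrightarrow> 0"
        using tendsto_mult_left[OF tendsto_norm[OF LIM_zero[OF Bx]], of "2 / chi"] by simp
    qed
    ultimately show ?thesis using tendsto_add by fastforce
  qed
  \<comment> \<open>This is the subgradient at \<open>t n\<close> produced by the exact step. As
    \<open>\<gamma> n\<close> stays above \<open>eps\<close>, the scaled residual vanishes and
    \<open>u\<close> converges strongly to \<open>- B z\<close>.\<close>
  define u where "u n = (1 / \<gamma> n) *\<^sub>R (x n - t n) - B (x n)" for n
  have u: "subgrad_on D F (t n) (u n)" for n
    using t[of n] \<gamma>pos[of n] by (simp add: u_def scaleR_diff_right algebra_simps)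
  have u_lim: "u \<longlonglongrightarrow> - B z"
  proof -
    have "(\<lambda>n. (1 / \<gamma> n) *\<^sub>R (x n - t n)) \<longlonglongrightarrow> 0"
    proof (rule Lim_null_comparison)
      have "norm ((1 / \<gamma> n) *\<^sub>R (x n - t n)) \<le> 1 / eps * norm (x n - t n)" for n
      proof -
        have "1 / \<gamma> n \<le> 1 / eps" using gamma(1)[of n] eps by (simp add: frac_le)
        from mult_right_mono[OF this norm_ge_zero[of "x n - t n"]] show ?thesis using \<gamma>pos[of n] by simp
      qed
      then show "\<forall>\<^sub>F n in sequentially. norm ((1 / \<gamma> n) *\<^sub>R (x n - t n)) \<le> 1 / eps * norm (x n - t n)"
        by simp
      show "(\<lambda>n. 1 / eps * norm (x n - t n)) \<longlonglongrightarrow> 0"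
        using tendsto_mult_left[OF tendsto_norm[OF res_lim], of "1 / eps"] by simp
    qed
    from tendsto_diff[OF this Bx] show ?thesis by (simp add: u_def[abs_def])
  qed
  obtain M where M: "\<And>n. norm (x n - z) \<le> M"
    using convergent_imp_Bseq[OF norm_conv[OF z]] unfolding Bseq_def by auto
  obtain M' where M': "\<And>n. norm (x n - t n) \<le> M'"
    using convergent_imp_Bseq[of "\<lambda>n. x n - t n"] res_lim unfolding Bseq_def convergent_def by auto

  have cluster: "v \<in> D \<and> subgrad_on D F v (- B v) \<and> B v = B z"
    if G: "G \<le> sequentially" "G \<noteq> bot" and v: "v \<in> S"
      and weak: "\<And>w. w \<in> S \<Longrightarrow> ((\<lambda>n. inner (x n) w) \<longlongrightarrow> inner v w) G" for G v
  proof -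
    note toG = tendsto_mono[OF G(1)]
    have xv: "norm (x n - v) \<le> M + norm (z - v)" for n
      using norm_triangle_ineq[of "x n - z" "z - v"] M[of n] by simp
    \<comment> \<open>\<open>B (x n) - B v\<close> converges strongly while \<open>x n - v\<close>
      tends weakly to 0, so their inner product vanishes in the limit; cocoercivity then forces
      \<open>B (x n)\<close> to tend to \<open>B v\<close> along \<open>G\<close>.\<close>
    have "((\<lambda>n. inner (B (x n) - B v) (x n - v)) \<longlongrightarrow> 0) G"
    proof (rule tendsto_inner_strong_weak[OF tendsto_diff[OF toG[OF Bx] tendsto_const] xv])
      have "B z - B v \<in> S" using BS zS v S(2) by (simp add: subspace_diff)
      from tendsto_diff[OF weak[OF this] tendsto_const[of "inner v (B z - B v)"]]
      show "((\<lambda>n. inner (x n - v) (B z - B v)) \<longlongrightarrow> 0) G" by (simp add: inner_diff_left)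
    qed
    from tendsto_mult_left[OF this, of chi]
    have ub: "((\<lambda>n. chi * inner (B (x n) - B v) (x n - v)) \<longlongrightarrow> 0) G" by simp
    have "((\<lambda>n. (norm (B (x n) - B v))\<^sup>2) \<longlongrightarrow> 0) G"
    proof (rule tendsto_sandwich[OF _ _ tendsto_const ub])
      have "(norm (B (x n) - B v))\<^sup>2 \<le> chi * inner (B (x n) - B v) (x n - v)" for n
        using coco[OF x[of n] v] chi by (simp add: field_simps)
      then show "\<forall>\<^sub>F n in G. (norm (B (x n) - B v))\<^sup>2 \<le> chi * inner (B (x n) - B v) (x n - v)" by simp
    qed simp
    moreover have "((\<lambda>n. (norm (B (x n) - B v))\<^sup>2) \<longlongrightarrow> (norm (B z - B v))\<^sup>2) G"
      by (intro tendsto_intros toG[OF Bx])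
    ultimately have "(norm (B z - B v))\<^sup>2 = 0" using tendsto_unique[OF G(2)] by blast
    then have Bv: "B v = B z" by simp
    \<comment> \<open>Here \<open>v - B z - q\<close> is a subgradient at \<open>q\<close>. Pairing
      it monotonically with \<open>u n\<close> at \<open>t n\<close> and passing to the limit,
      strong in the first factor and weak in the second, leaves
      \<open>0 \<le> - inner (v - q) (v - q)\<close>. Once \<open>v = q\<close>, the subgradient at
      \<open>q\<close> becomes \<open>- B z = - B v\<close>.\<close>
    obtain q where q: "subgrad_on D F q ((1 / 1) *\<^sub>R (v - B z - q))"
      using res[of 1 "v - B z"] by auto
    have qS: "q \<in> S" using q DS by (auto simp: subgrad_on_def)
    have tq: "norm (t n - q) \<le> M + M' + norm (z - q)" for n
      using norm_triangle_ineq4[of "x n - q" "x n - t n"] M'[of n]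
        norm_triangle_ineq[of "x n - z" "z - q"] M[of n] by simp
    have "((\<lambda>n. inner (u n - (v - B z - q)) (t n - q)) \<longlongrightarrow> inner (v - q) (q - v)) G"
    proof (rule tendsto_inner_strong_weak[OF _ tq])
      show "((\<lambda>n. u n - (v - B z - q)) \<longlongrightarrow> q - v) G"
        using tendsto_diff[OF toG[OF u_lim] tendsto_const[of "v - B z - q"]] by (simp add: algebra_simps)
      have "((\<lambda>n. inner (x n) (q - v) - inner (x n - t n) (q - v) - inner q (q - v))
          \<longlongrightarrow> inner v (q - v) - inner 0 (q - v) - inner q (q - v)) G"
        by (intro tendsto_intros weak toG[OF res_lim]) (use qS v S(2) in \<open>simp add: subspace_diff\<close>)
      then show "((\<lambda>n. inner (t n - q) (q - v)) \<longlongrightarrow> inner (v - q) (q - v)) G"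
        by (simp add: inner_diff_left)
    qed
    moreover have "0 \<le> inner (u n - (v - B z - q)) (t n - q)" for n
      using subgrad_on_monotone[OF u q] by simp
    ultimately have "0 \<le> inner (v - q) (q - v)"
      using tendsto_lowerbound[OF _ _ G(2)] by (metis (no_types, lifting) eventuallyI)
    moreover have "inner (v - q) (q - v) = - inner (v - q) (v - q)"
      by (simp add: inner_diff_right)
    ultimately have "v = q" using inner_ge_zero[of "v - q"] by simp
    then show ?thesis using q Bv by (auto simp: subgrad_on_def)
  qed
  \<comment> \<open>Recording \<open>B v = B z\<close> in the target set identifies the strong limit
    of \<open>B (x n)\<close> with the value of \<open>B\<close> at the weak limit.\<close>
  define Z where "Z = {v. subgrad_on D F v (- B v) \<and> B v = B z}"
  have Zne: "Z \<noteq> {}" using z by (auto simp: Z_def)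
  have Zconv: "convergent (\<lambda>n. norm (x n - v))" if "v \<in> Z" for v
    using that unfolding Z_def by (blast intro: norm_conv)
  have Zcl: "v \<in> Z" if "G \<le> sequentially" "G \<noteq> bot" "v \<in> S"
      "\<And>w. w \<in> S \<Longrightarrow> ((\<lambda>n. inner (x n) w) \<longlongrightarrow> inner v w) G" for G v
    using cluster[OF that] unfolding Z_def by blast
  obtain xb where xb: "xb \<in> Z \<inter> S" "\<forall>w. (\<lambda>n. inner (x n) w) \<longlonglongrightarrow> inner xb w"
    by (rule bexE[OF opial[where X = x, OF S x Zne Zconv Zcl]])
  show ?thesis
  proof (intro bexI conjI)
    show "xb \<in> S" using xb(1) by simp
    show "subgrad_on D F xb (- B xb)" using xb(1) unfolding Z_def by blast
    show "(\<lambda>n. B (x n)) \<longlonglongrightarrow> B xb" using xb(1) Bx by (simp add: Z_def)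
  qed (rule xb(2))
qed

section \<open>Direct sums\<close>

text \<open>Finitely supported sequences carry the inner product of the direct sum for every number of
  summands at once; \<open>prodH m V\<close> becomes a complete subspace, although the whole type is not complete.\<close>

typedef (overloaded) 'a fin_seq = "{x :: nat \<Rightarrow> 'a::zero. finite {i. x i \<noteq> 0}}"
  morphisms nth_fs Abs_fs
  by (rule exI[of _ "\<lambda>_. 0"]) simp

setup_lifting type_definition_fin_seq

lemma finite_support_nth_fs [simp]: "finite {i. nth_fs x i \<noteq> 0}"
  using nth_fs[of x] by simp

lemma fin_seq_eqI: "(\<And>i. nth_fs x i = nth_fs y i) \<Longrightarrow> x = y"
  by (metis ext nth_fs_inject)

instantiation fin_seq :: (real_vector) real_vector
begin

lift_definition zero_fin_seq :: "'a fin_seq" is "\<lambda>_. 0" by simp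

lift_definition plus_fin_seq :: "'a fin_seq \<Rightarrow> 'a fin_seq \<Rightarrow> 'a fin_seq" is "\<lambda>x y i. x i + y i"
  subgoal for x y
    by (rule finite_subset[of _ "{i. x i \<noteq> 0} \<union> {i. y i \<noteq> 0}"]) auto
  done

lift_definition minus_fin_seq :: "'a fin_seq \<Rightarrow> 'a fin_seq \<Rightarrow> 'a fin_seq" is "\<lambda>x y i. x i - y i"
  subgoal for x y
    by (rule finite_subset[of _ "{i. x i \<noteq> 0} \<union> {i. y i \<noteq> 0}"]) auto
  done

lift_definition uminus_fin_seq :: "'a fin_seq \<Rightarrow> 'a fin_seq" is "\<lambda>x i. - x i"
  by simp

lift_definition scaleR_fin_seq :: "real \<Rightarrow> 'a fin_seq \<Rightarrow> 'a fin_seq" is "\<lambda>c x i. c *\<^sub>R x i"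
  by (erule rev_finite_subset) auto

instance
proof
  fix x y z :: "'a fin_seq" and a b :: real
  show "x + y + z = x + (y + z)" by transfer (simp add: add.assoc)
  show "x + y = y + x" by transfer (simp add: add.commute)
  show "0 + x = x" by transfer simp
  show "- x + x = 0" by transfer simp
  show "x - y = x + - y" by transfer simp
  show "a *\<^sub>R (x + y) = a *\<^sub>R x + a *\<^sub>R y" by transfer (simp add: scaleR_add_right)
  show "(a + b) *\<^sub>R x = a *\<^sub>R x + b *\<^sub>R x" by transfer (simp add: scaleR_add_left)
  show "a *\<^sub>R b *\<^sub>R x = (a * b) *\<^sub>R x" by transfer simp
  show "1 *\<^sub>R x = x" by transfer simp
qed

end

instantiation fin_seq :: (real_inner) real_inner
begin

definition inner_fin_seq :: "'a fin_seq \<Rightarrow> 'a fin_seq \<Rightarrow> real" where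
  "inner_fin_seq x y = (\<Sum>i | nth_fs x i \<noteq> 0. inner (nth_fs x i) (nth_fs y i))"

definition norm_fin_seq :: "'a fin_seq \<Rightarrow> real" where
  "norm_fin_seq x = sqrt (inner x x)"

definition dist_fin_seq :: "'a fin_seq \<Rightarrow> 'a fin_seq \<Rightarrow> real" where
  "dist_fin_seq x y = norm (x - y)"

definition sgn_fin_seq :: "'a fin_seq \<Rightarrow> 'a fin_seq" where
  "sgn_fin_seq x = x /\<^sub>R norm x"

definition uniformity_fin_seq :: "('a fin_seq \<times> 'a fin_seq) filter" where
  "uniformity_fin_seq = (INF e\<in>{0<..}. principal {(x, y). dist x y < e})"

definition open_fin_seq :: "'a fin_seq set \<Rightarrow> bool" where
  "open_fin_seq U = (\<forall>x\<in>U. \<forall>\<^sub>F (x', y) in uniformity. x' = x \<longrightarrow> y \<in> U)"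

text \<open>Allows inner products of several vectors to be summed over one common finite index set,
  from which bilinearity and symmetry are read off termwise.\<close>

lemma inner_fin_seq_superset:
  fixes x y :: "'a fin_seq"
  assumes "finite A" "\<And>i. i \<notin> A \<Longrightarrow> nth_fs x i = 0 \<or> nth_fs y i = 0"
  shows "inner x y = (\<Sum>i\<in>A. inner (nth_fs x i) (nth_fs y i))"
proof -
  have zero: "inner (nth_fs x i) (nth_fs y i) = 0" if "i \<notin> A" for i
    using assms(2)[OF that] by auto
  have "inner x y = (\<Sum>i\<in>{i. nth_fs x i \<noteq> 0} \<union> A. inner (nth_fs x i) (nth_fs y i))"
    unfolding inner_fin_seq_def by (rule sum.mono_neutral_left) (use assms(1) in auto)
  also have "\<dots> = (\<Sum>i\<in>A. inner (nth_fs x i) (nth_fs y i))"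
    by (rule sum.mono_neutral_right) (use assms(1) zero in auto)
  finally show ?thesis .
qed

instance
proof
  fix x y z :: "'a fin_seq" and r :: real
  show "dist x y = norm (x - y)" by (rule dist_fin_seq_def)
  show "sgn x = x /\<^sub>R norm x" by (rule sgn_fin_seq_def)
  show "uniformity = (INF e\<in>{0<..}. principal {(x, y :: 'a fin_seq). dist x y < e})"
    by (rule uniformity_fin_seq_def)
  show "open U = (\<forall>x\<in>U. \<forall>\<^sub>F (x', y) in uniformity. x' = x \<longrightarrow> y \<in> U)" for U :: "'a fin_seq set"
    by (rule open_fin_seq_def)
  define A where "A = {i. nth_fs x i \<noteq> 0} \<union> {i. nth_fs y i \<noteq> 0} \<union> {i. nth_fs z i \<noteq> 0}"
  have A: "finite A" by (simp add: A_def)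
  have supp: "inner u v = (\<Sum>i\<in>A. inner (nth_fs u i) (nth_fs v i))"
    if "\<And>i. i \<notin> A \<Longrightarrow> nth_fs u i = 0" for u v :: "'a fin_seq"
    using A that by (intro inner_fin_seq_superset) auto
  have zero: "nth_fs x i = 0" "nth_fs y i = 0" "nth_fs z i = 0" if "i \<notin> A" for i
    using that by (auto simp: A_def)
  show "inner x y = inner y x" by (simp add: supp zero inner_commute)
  show "inner (x + y) z = inner x z + inner y z"
    by (simp add: supp zero plus_fin_seq.rep_eq inner_add_left sum.distrib)
  show "inner (r *\<^sub>R x) y = r * inner x y"
    by (simp add: supp zero scaleR_fin_seq.rep_eq sum_distrib_left)
  show "0 \<le> inner x x" by (simp add: inner_fin_seq_def sum_nonneg)
  show "inner x x = 0 \<longleftrightarrow> x = 0"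
  proof
    assume "inner x x = 0"
    then have "nth_fs x i = 0" for i
      by (auto simp: inner_fin_seq_def sum_nonneg_eq_0_iff)
    then show "x = 0" by (intro fin_seq_eqI) (simp add: zero_fin_seq.rep_eq)
  qed (simp add: inner_fin_seq_def zero_fin_seq.rep_eq)
  show "norm x = sqrt (inner x x)" by (rule norm_fin_seq_def)
qed

end

lemma norm_nth_fs_le: "norm (nth_fs x i) \<le> norm (x :: 'a::real_inner fin_seq)"
proof (cases "nth_fs x i = 0")
  case False
  then have "inner (nth_fs x i) (nth_fs x i) \<le> inner x x"
    unfolding inner_fin_seq_def by (intro member_le_sum) auto
  then show ?thesis by (simp add: norm_eq_sqrt_inner)
qed simp

lemma tendsto_nth_fs:
  fixes s :: "'i \<Rightarrow> 'a::real_inner fin_seq"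
  assumes "(s \<longlongrightarrow> l) G"
  shows "((\<lambda>n. nth_fs (s n) i) \<longlongrightarrow> nth_fs l i) G"
proof -
  have "((\<lambda>n. nth_fs (s n - l) i) \<longlongrightarrow> 0) G"
    by (rule Lim_null_comparison[OF _ tendsto_norm_zero[OF LIM_zero[OF assms]]])
      (simp add: norm_nth_fs_le)
  then show ?thesis by (simp add: minus_fin_seq.rep_eq LIM_zero_cancel)
qed

text \<open>Along the segment from \<open>a\<close> to \<open>t\<close>, which stays in
  \<open>V\<close>, convexity bounds every difference quotient at 0 by the full increment
  \<open>\<phi> t - \<phi> a\<close>; the derivative within \<open>V\<close> is the limit of these
  quotients.\<close>

lemma convex_on_above_gradient:
  fixes \<phi> :: "'a::real_inner \<Rightarrow> real"
  assumes conv: "convex_on V \<phi>" and deriv: "(\<phi> has_derivative (\<lambda>h. inner v h)) (at a within V)"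
    and V: "a \<in> V" "t \<in> V"
  shows "\<phi> a + inner v (t - a) \<le> \<phi> t"
proof -
  define c where "c s = a + s *\<^sub>R (t - a)" for s :: real
  have c: "c s = (1 - s) *\<^sub>R a + s *\<^sub>R t" for s by (simp add: c_def algebra_simps)
  have "convex V" using conv by (simp add: convex_on_def)
  then have "c ` {0..1} \<subseteq> V" unfolding c using V by (auto simp: convex_alt)
  then have "(\<phi> has_derivative (\<lambda>h. inner v h)) (at (c 0) within c ` {0..1})"
    using deriv by (simp add: c_def has_derivative_subset)
  moreover have "(c has_derivative (\<lambda>s. s *\<^sub>R (t - a))) (at 0 within {0..1})"
    unfolding c_def by (auto intro!: derivative_eq_intros)
  ultimately have "((\<phi> \<circ> c) has_derivative ((\<lambda>h. inner v h) \<circ> (\<lambda>s. s *\<^sub>R (t - a)))) (at 0 within {0..1})"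
    by (rule diff_chain_within[rotated])
  then have "((\<phi> \<circ> c) has_real_derivative inner v (t - a)) (at 0 within {0..1})"
    by (simp add: has_field_derivative_def o_def mult.commute[of _ "inner v (t - a)"])
  then have lim: "((\<lambda>s. (\<phi> (c s) - \<phi> a) / s) \<longlongrightarrow> inner v (t - a)) (at 0 within {0..1})"
    by (simp add: has_field_derivative_iff c_def)
  have "inner v (t - a) \<le> \<phi> t - \<phi> a"
  proof (rule tendsto_upperbound[OF lim])
    have "(\<phi> (c s) - \<phi> a) / s \<le> \<phi> t - \<phi> a" if "s \<in> {0..1}" "s \<noteq> 0" for s
    proof -
      have "\<phi> (c s) \<le> (1 - s) * \<phi> a + s * \<phi> t"
        unfolding c using conv that V by (intro convex_onD) auto
      then show ?thesis using that by (simp add: field_simps)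
    qed
    then show "\<forall>\<^sub>F s in at 0 within {0..1}. (\<phi> (c s) - \<phi> a) / s \<le> \<phi> t - \<phi> a"
      by (auto simp: eventually_at_filter)
    show "at 0 within {0..1::real} \<noteq> bot" by (simp add: at_within_Icc_at_right)
  qed
  then show ?thesis by simp
qed

section \<open>Transfer of \<open>f\<close>, its subdifferential and its proximal map to finitely
  supported sequences\<close>

definition fs_space :: "nat \<Rightarrow> (nat \<Rightarrow> 'a::real_vector set) \<Rightarrow> 'a fin_seq set" where
  "fs_space m V = {p. nth_fs p \<in> prodH m V}"

definition fs_dom :: "nat \<Rightarrow> (nat \<Rightarrow> 'a::real_vector set) \<Rightarrow> ((nat \<Rightarrow> 'a) \<Rightarrow> ereal) \<Rightarrow> 'a fin_seq set" where
  "fs_dom m V f = {p \<in> fs_space m V. f (nth_fs p) \<noteq> \<infinity>}"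

text \<open>Infinite values are sent to 0 by \<open>real_of_ereal\<close>, so this represents
  \<open>f\<close> only on \<open>fs_dom\<close>, where properness makes \<open>f\<close>
  finite.\<close>

definition fs_fun :: "((nat \<Rightarrow> 'a::real_vector) \<Rightarrow> ereal) \<Rightarrow> 'a fin_seq \<Rightarrow> real" where
  "fs_fun f p = real_of_ereal (f (nth_fs p))"

lemma nth_Abs_fs:
  assumes "h \<in> prodH m V"
  shows "nth_fs (Abs_fs h) = h"
proof -
  have "{i. h i \<noteq> 0} \<subseteq> {..<m}" using assms by (force simp: prodH_def not_less[symmetric])
  then have "finite {i. h i \<noteq> 0}" by (rule finite_subset) simp
  then show ?thesis by (simp add: Abs_fs_inverse)
qed

lemma Abs_fs_in_fs_space: "h \<in> prodH m V \<Longrightarrow> Abs_fs h \<in> fs_space m V"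
  by (simp add: fs_space_def nth_Abs_fs)

lemma nth_fs_mem: "p \<in> fs_space m V \<Longrightarrow> nth_fs p \<in> prodH m V"
  by (simp add: fs_space_def)

lemma inner_fs_space:
  assumes "p \<in> fs_space m V"
  shows "inner p q = (\<Sum>i<m. inner (nth_fs p i) (nth_fs q i))"
    and "inner q p = (\<Sum>i<m. inner (nth_fs q i) (nth_fs p i))"
  using assms by (auto intro!: inner_fin_seq_superset simp: fs_space_def prodH_def)

lemma pnorm_fs_space: "p \<in> fs_space m V \<Longrightarrow> pnorm m (nth_fs p) = norm p"
  by (simp add: pnorm_def pinner_def inner_fs_space(1) norm_eq_sqrt_inner)

lemma norm_fs_space_le_sum:
  assumes "p \<in> fs_space m V"
  shows "norm p \<le> (\<Sum>i<m. norm (nth_fs p i))"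
proof -
  have "norm p = L2_set (\<lambda>i. norm (nth_fs p i)) {..<m}"
    by (simp add: norm_eq_sqrt_inner[of p] inner_fs_space(1)[OF assms] L2_set_def power2_norm_eq_inner)
  also have "\<dots> \<le> (\<Sum>i<m. norm (nth_fs p i))" by (rule L2_set_le_sum) simp
  finally show ?thesis .
qed

lemma subspace_fs_space:
  assumes "\<And>i. i < m \<Longrightarrow> subspace (V i)"
  shows "subspace (fs_space m V)"
  unfolding subspace_def fs_space_def prodH_def
  using assms
  by (auto simp: zero_fin_seq.rep_eq plus_fin_seq.rep_eq scaleR_fin_seq.rep_eq
      subspace_0 subspace_add subspace_scale)

lemma tendsto_fs_space:
  fixes s :: "nat \<Rightarrow> 'a::real_inner fin_seq"
  assumes V: "\<And>i. i < m \<Longrightarrow> subspace (V i)" and s: "\<And>n. s n \<in> fs_space m V" "l \<in> fs_space m V"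
    and lim: "\<And>i. i < m \<Longrightarrow> (\<lambda>n. nth_fs (s n) i) \<longlonglongrightarrow> nth_fs l i"
  shows "s \<longlonglongrightarrow> l"
proof (rule LIM_zero_cancel, rule Lim_null_comparison)
  have "norm (s n - l) \<le> (\<Sum>i<m. norm (nth_fs (s n) i - nth_fs l i))" for n
    using norm_fs_space_le_sum[OF subspace_diff[OF subspace_fs_space[of m V, OF V] s(1)[of n] s(2)]]
    by (simp add: minus_fin_seq.rep_eq)
  then show "\<forall>\<^sub>F n in sequentially. norm (s n - l) \<le> (\<Sum>i<m. norm (nth_fs (s n) i - nth_fs l i))"
    by simp
  have "(\<lambda>n. \<Sum>i<m. norm (nth_fs (s n) i - nth_fs l i)) \<longlonglongrightarrow> (\<Sum>i<m. norm (nth_fs l i - nth_fs l i))"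
    by (intro tendsto_intros lim) auto
  then show "(\<lambda>n. \<Sum>i<m. norm (nth_fs (s n) i - nth_fs l i)) \<longlonglongrightarrow> 0" by simp
qed

text \<open>Coordinates of a Cauchy sequence are Cauchy and their limits stay in the closed sets
  \<open>V i\<close>; with only \<open>m\<close> coordinates, coordinatewise convergence is norm
  convergence.\<close>

lemma complete_fs_space:
  fixes V :: "nat \<Rightarrow> 'a::{real_inner, complete_space} set"
  assumes V: "\<And>i. i < m \<Longrightarrow> subspace (V i)" "\<And>i. i < m \<Longrightarrow> closed (V i)"
  shows "complete (fs_space m V)"
  unfolding complete_def
proof (intro allI impI)
  fix s assume "(\<forall>n. s n \<in> fs_space m V) \<and> Cauchy s"
  then have s: "\<And>n. s n \<in> fs_space m V" and "Cauchy s" by auto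
  have cauchy: "Cauchy (\<lambda>n. nth_fs (s n) i)" for i
  proof (rule metric_CauchyI)
    fix e :: real assume "e > 0"
    then obtain N where N: "\<And>a b. a \<ge> N \<Longrightarrow> b \<ge> N \<Longrightarrow> dist (s a) (s b) < e"
      using \<open>Cauchy s\<close> metric_CauchyD by blast
    have "dist (nth_fs (s a) i) (nth_fs (s b) i) \<le> dist (s a) (s b)" for a b
      using norm_nth_fs_le[of "s a - s b" i] by (simp add: dist_norm minus_fin_seq.rep_eq)
    then show "\<exists>N. \<forall>a\<ge>N. \<forall>b\<ge>N. dist (nth_fs (s a) i) (nth_fs (s b) i) < e"
      using N by (meson le_less_trans)
  qed
  define l where "l i = (if i < m then lim (\<lambda>n. nth_fs (s n) i) else 0)" for i
  have lim: "(\<lambda>n. nth_fs (s n) i) \<longlonglongrightarrow> l i" if "i < m" for i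
    using cauchy[of i] that by (simp add: l_def Cauchy_convergent_iff convergent_LIMSEQ_iff)
  have "l i \<in> V i" if "i < m" for i
    using closed_sequentially[OF V(2)[OF that] _ lim[OF that]] s that by (simp add: fs_space_def prodH_def)
  then have l: "l \<in> prodH m V" by (simp add: prodH_def l_def)
  have "s \<longlonglongrightarrow> Abs_fs l"
    by (rule tendsto_fs_space[of m V, OF V(1) s Abs_fs_in_fs_space[OF l]])
      (use lim in \<open>simp_all add: nth_Abs_fs[OF l]\<close>)
  then show "\<exists>l\<in>fs_space m V. s \<longlonglongrightarrow> l" using Abs_fs_in_fs_space[OF l] by blast
qed

lemma fs_dom_subset: "fs_dom m V f \<subseteq> fs_space m V"
  by (auto simp: fs_dom_def)

lemma fs_fun_eq:
  assumes "proper_on (prodH m V) f" "p \<in> fs_dom m V f"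
  shows "f (nth_fs p) = ereal (fs_fun f p)"
  using assms by (cases "f (nth_fs p)") (auto simp: fs_fun_def fs_dom_def fs_space_def proper_on_def)

lemma convex_on_fs_fun:
  assumes V: "\<And>i. i < m \<Longrightarrow> subspace (V i)" and f: "Gamma0_prod m V f"
  shows "convex_on (fs_dom m V f) (fs_fun f)"
proof -
  have proper: "proper_on (prodH m V) f" and conv: "convex_ereal_on (prodH m V) f"
    using f by (auto simp: Gamma0_prod_def)
  have *: "(1 - t) *\<^sub>R p + t *\<^sub>R q \<in> fs_dom m V f \<and>
      fs_fun f ((1 - t) *\<^sub>R p + t *\<^sub>R q) \<le> (1 - t) * fs_fun f p + t * fs_fun f q"
    if t: "0 < t" "t < 1" and p: "p \<in> fs_dom m V f" and q: "q \<in> fs_dom m V f" for p q t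
  proof -
    let ?w = "(1 - t) *\<^sub>R p + t *\<^sub>R q"
    have w: "?w \<in> fs_space m V"
      using p q subspace_fs_space[of m V, OF V] fs_dom_subset[of m V f]
      by (meson subsetD subspace_add subspace_scale)
    \<comment> \<open>\<open>convex_ereal_on\<close> attaches its parameter to the first point and
      \<open>convex_on\<close> to the second, so the former is instantiated at
      \<open>1 - t\<close>.\<close>
    have w_eq: "nth_fs ?w = (\<lambda>i. (1 - t) *\<^sub>R nth_fs p i + (1 - (1 - t)) *\<^sub>R nth_fs q i)"
      by (simp add: fun_eq_iff plus_fin_seq.rep_eq scaleR_fin_seq.rep_eq)
    have "nth_fs p \<in> prodH m V" "nth_fs q \<in> prodH m V" "0 < 1 - t \<and> 1 - t < 1"
      using p q t by (auto simp: fs_dom_def fs_space_def)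
    from conv[unfolded convex_ereal_on_def, rule_format, OF this]
    have "f (nth_fs ?w) \<le> ereal (1 - t) * f (nth_fs p) + ereal (1 - (1 - t)) * f (nth_fs q)"
      unfolding w_eq .
    then have le: "f (nth_fs ?w) \<le> ereal ((1 - t) * fs_fun f p + t * fs_fun f q)"
      by (simp add: fs_fun_eq[OF proper p] fs_fun_eq[OF proper q])
    then have dom: "?w \<in> fs_dom m V f" using w by (auto simp: fs_dom_def)
    with le show ?thesis by (simp add: fs_fun_eq[OF proper dom])
  qed
  have "convex (fs_dom m V f)"
    unfolding convex_alt
  proof (intro ballI allI impI)
    fix p q and t :: real
    assume "p \<in> fs_dom m V f" "q \<in> fs_dom m V f" "0 \<le> t \<and> t \<le> 1"
    \<comment> \<open>The endpoints are treated apart because \<open>convex_ereal_on\<close> speaks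
      of \<open>0 < t < 1\<close> only.\<close>
    then show "(1 - t) *\<^sub>R p + t *\<^sub>R q \<in> fs_dom m V f"
      using *[of t p q] by (cases "t = 0 \<or> t = 1") auto
  qed
  with * show ?thesis by (intro convex_onI) auto
qed

text \<open>Along values converging to a real \<open>c\<close> the lower limit is \<open>c\<close>,
  so lower semicontinuity bounds \<open>f\<close> at the limit by a finite number, which also places
  the limit in the domain.\<close>

lemma closed_fun_on_fs_fun:
  assumes f: "Gamma0_prod m V f"
  shows "closed_fun_on (fs_space m V) (fs_dom m V f) (fs_fun f)"
proof (rule closed_fun_onI)
  fix s l c
  assume s: "\<And>n. s n \<in> fs_dom m V f" and l: "l \<in> fs_space m V" "s \<longlonglongrightarrow> l"
    and c: "(\<lambda>n. fs_fun f (s n)) \<longlonglongrightarrow> c"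
  have proper: "proper_on (prodH m V) f" and lsc: "lsc_prod m V f"
    using f by (auto simp: Gamma0_prod_def)
  have "\<And>n. nth_fs (s n) \<in> prodH m V" "nth_fs l \<in> prodH m V"
    using s l(1) by (auto simp: fs_dom_def fs_space_def)
  then have "f (nth_fs l) \<le> liminf (\<lambda>n. f (nth_fs (s n)))"
    using lsc[unfolded lsc_prod_def, rule_format, of "\<lambda>n. nth_fs (s n)" "nth_fs l"]
      tendsto_nth_fs[OF l(2)] by simp
  also have "\<dots> = liminf (\<lambda>n. ereal (fs_fun f (s n)))"
    by (simp add: fs_fun_eq[OF proper s])
  also have "\<dots> = ereal c"
    by (rule lim_imp_Liminf) (use c in auto)
  finally have le: "f (nth_fs l) \<le> ereal c" .
  then have dom: "l \<in> fs_dom m V f" using l(1) by (auto simp: fs_dom_def)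
  with le show "l \<in> fs_dom m V f \<and> fs_fun f l \<le> c" by (simp add: fs_fun_eq[OF proper dom])
qed

text \<open>Points outside the domain impose no condition, as \<open>f\<close> is infinite
  there.\<close>

lemma subdiff_prod_iff_subgrad_on:
  assumes proper: "proper_on (prodH m V) f" and p: "p \<in> fs_space m V" and u: "u \<in> fs_space m V"
  shows "nth_fs u \<in> subdiff_prod m V f (nth_fs p) \<longleftrightarrow> subgrad_on (fs_dom m V f) (fs_fun f) p u"
proof -
  have fin: "\<bar>f (nth_fs p)\<bar> \<noteq> \<infinity> \<longleftrightarrow> p \<in> fs_dom m V f"
    using proper p by (auto simp: fs_dom_def fs_space_def proper_on_def)
  have pin: "pinner m (nth_fs u) (psub (nth_fs q) (nth_fs p)) = inner u (q - p)" for q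
    by (simp add: inner_fs_space(1)[OF u] pinner_def psub_def minus_fin_seq.rep_eq)
  have all: "(\<forall>h\<in>prodH m V. P h) \<longleftrightarrow> (\<forall>q\<in>fs_space m V. P (nth_fs q))" for P
    by (metis Abs_fs_in_fs_space nth_Abs_fs nth_fs_mem)
  have "(\<forall>h\<in>prodH m V. f (nth_fs p) + ereal (pinner m (nth_fs u) (psub h (nth_fs p))) \<le> f h)
      \<longleftrightarrow> (\<forall>q\<in>fs_dom m V f. fs_fun f p + inner u (q - p) \<le> fs_fun f q)" if "p \<in> fs_dom m V f"
  proof -
    have "f (nth_fs p) + ereal (inner u (q - p)) \<le> f (nth_fs q) \<longleftrightarrow>
        (q \<in> fs_dom m V f \<longrightarrow> fs_fun f p + inner u (q - p) \<le> fs_fun f q)" if "q \<in> fs_space m V" for q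
      using that fs_fun_eq[OF proper \<open>p \<in> fs_dom m V f\<close>] fs_fun_eq[OF proper, of q]
      by (cases "q \<in> fs_dom m V f") (auto simp: fs_dom_def)
    then show ?thesis unfolding all pin using fs_dom_subset[of m V f] by blast
  qed
  then show ?thesis
    using p u fin by (auto simp: subdiff_prod_def subgrad_on_def nth_fs_mem)
qed

text \<open>Discharges the definite description in \<open>prox_prod\<close>: any competing minimiser
  has a finite objective, hence lies in the domain, and quadratic growth puts it at distance 0 from
  \<open>p\<close>.\<close>

lemma prox_prod_eq_resolvent:
  assumes V: "\<And>i. i < m \<Longrightarrow> subspace (V i)" and proper: "proper_on (prodH m V) f" and r: "r > 0"
    and h: "h \<in> prodH m V"
    and p: "subgrad_on (fs_dom m V f) (fs_fun f) p ((1/r) *\<^sub>R (Abs_fs h - p))"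
  shows "prox_prod m V (\<lambda>q. ereal r * f q) h = nth_fs p"
proof -
  define J where "J q = ereal r * f q + ereal ((pnorm m (psub h q))\<^sup>2 / 2)" for q
  have pD: "p \<in> fs_dom m V f" using p by (simp add: subgrad_on_def)
  note hS = Abs_fs_in_fs_space[OF h]
  have J: "J (nth_fs q) = ereal (r * fs_fun f q + (norm (Abs_fs h - q))\<^sup>2 / 2)" if "q \<in> fs_dom m V f" for q
  proof -
    have "psub h (nth_fs q) = nth_fs (Abs_fs h - q)"
      by (simp add: fun_eq_iff psub_def minus_fin_seq.rep_eq nth_Abs_fs[OF h])
    moreover have "Abs_fs h - q \<in> fs_space m V"
      using subspace_diff[OF subspace_fs_space[of m V, OF V] hS] that fs_dom_subset by blast
    ultimately show ?thesis
      by (simp add: J_def fs_fun_eq[OF proper that] pnorm_fs_space)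
  qed
  have J_inf: "J (nth_fs q) = \<infinity>" if "q \<in> fs_space m V" "q \<notin> fs_dom m V f" for q
    using that r by (simp add: J_def fs_dom_def)
  have min: "J (nth_fs p) \<le> J q" if "q \<in> prodH m V" for q
  proof (cases "Abs_fs q \<in> fs_dom m V f")
    case True
    have "r * fs_fun f p + (norm (Abs_fs h - p))\<^sup>2 / 2
        \<le> r * fs_fun f (Abs_fs q) + (norm (Abs_fs h - Abs_fs q))\<^sup>2 / 2"
      using resolvent_minimizes[OF r p True] zero_le_power2[of "norm (Abs_fs q - p)"] by argo
    then have "J (nth_fs p) \<le> J (nth_fs (Abs_fs q))"
      by (simp only: J[OF pD] J[OF True] ereal_less_eq)
    then show ?thesis by (simp add: nth_Abs_fs[OF that])
  next
    case False
    then show ?thesis using J_inf[OF Abs_fs_in_fs_space[OF that]] by (simp add: nth_Abs_fs[OF that])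
  qed
  have "q = nth_fs p" if q: "q \<in> prodH m V" and q_min: "\<And>q'. q' \<in> prodH m V \<Longrightarrow> J q \<le> J q'" for q
  proof -
    have le: "J (nth_fs (Abs_fs q)) \<le> J (nth_fs p)"
      using q_min[of "nth_fs p"] pD fs_dom_subset[of m V f] by (auto simp: nth_Abs_fs[OF q] nth_fs_mem)
    then have dom: "Abs_fs q \<in> fs_dom m V f"
      using J_inf[OF Abs_fs_in_fs_space[OF q]] J[OF pD] by force
    have "r * fs_fun f (Abs_fs q) + (norm (Abs_fs h - Abs_fs q))\<^sup>2 / 2
        \<le> r * fs_fun f p + (norm (Abs_fs h - p))\<^sup>2 / 2"
      using le by (simp only: J[OF pD] J[OF dom] ereal_less_eq)
    then have "(norm (Abs_fs q - p))\<^sup>2 \<le> 0"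
      using resolvent_minimizes[OF r p dom] by argo
    then have "Abs_fs q = p" by simp
    then show ?thesis using nth_Abs_fs[OF q] by simp
  qed
  then show ?thesis
    unfolding prox_prod_def using pD fs_dom_subset[of m V f] min
    by (intro the_equality) (auto simp: J_def nth_fs_mem subsetD)
qed

section \<open>Forward-backward iteration in the direct sum and passage from zeros to solutions of
  the minimisation problems\<close>

theorem theorem3p4:
  fixes m :: nat
    and V :: "nat \<Rightarrow> 'a::{real_inner, complete_space} set"
    and f :: "(nat \<Rightarrow> 'a) \<Rightarrow> ereal"
    and g :: "nat \<Rightarrow> (nat \<Rightarrow> 'a) \<Rightarrow> real"
    and grad :: "nat \<Rightarrow> (nat \<Rightarrow> 'a) \<Rightarrow> 'a"
    and chi eps :: real
    and \<gamma> :: "nat \<Rightarrow> real"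
    and x a b y :: "nat \<Rightarrow> nat \<Rightarrow> 'a"
  assumes m2: "2 \<le> m"
    and V_sub: "\<And>i. i < m \<Longrightarrow> subspace (V i) \<and> closed (V i)"
    and f_G0: "Gamma0_prod m V f"
    and g_conv: "\<And>i z. i < m \<Longrightarrow> z \<in> prodH m V \<Longrightarrow> convex_on (V i) (\<lambda>t. g i (z(i := t)))"
    and grad_in: "\<And>i z. i < m \<Longrightarrow> z \<in> prodH m V \<Longrightarrow> grad i z \<in> V i"
    and g_diff: "\<And>i z. i < m \<Longrightarrow> z \<in> prodH m V \<Longrightarrow>
        ((\<lambda>t. g i (z(i := t))) has_derivative (\<lambda>h. inner (grad i z) h)) (at (z i) within V i)"
    and g_mono: "\<And>u v. u \<in> prodH m V \<Longrightarrow> v \<in> prodH m V \<Longrightarrow>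
        (\<Sum>i<m. inner (grad i u - grad i v) (u i - v i)) \<ge> 0"
    and zero_ex: "\<exists>z\<in>prodH m V. (\<lambda>i. - Grad m grad z i) \<in> subdiff_prod m V f z"
    and chi_pos: "0 < chi"
    and cocoercive: "\<And>u v. u \<in> prodH m V \<Longrightarrow> v \<in> prodH m V \<Longrightarrow>
        (\<Sum>i<m. inner (grad i u - grad i v) (u i - v i)) \<ge>
          (1 / chi) * (\<Sum>i<m. (norm (grad i u - grad i v))\<^sup>2)"
    and eps_bd: "0 < eps" "eps < 2 / (chi + 1)"
    and gamma: "\<And>n. eps \<le> \<gamma> n \<and> \<gamma> n \<le> (2 - eps) / chi"
    and x0: "x 0 \<in> prodH m V"
    and a_in: "\<And>n. a n \<in> prodH m V"
    and b_in: "\<And>n. b n \<in> prodH m V"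
    and a_sum: "\<And>i. i < m \<Longrightarrow> summable (\<lambda>n. norm (a n i))"
    and b_sum: "\<And>i. i < m \<Longrightarrow> summable (\<lambda>n. norm (b n i))"
    and y_def: "\<And>n. y n = (\<lambda>i. if i < m then x n i - \<gamma> n *\<^sub>R (grad i (x n) + a n i) else 0)"
    and x_step: "\<And>n. x (Suc n) =
        (\<lambda>i. prox_prod m V (\<lambda>p. ereal (\<gamma> n) * f p) (y n) i + b n i)"
  shows "\<exists>xb. solves_P m V f g xb \<and>
           (\<forall>i<m. weak_conv (\<lambda>n. x n i) (xb i) \<and> (\<lambda>n. grad i (x n)) \<longlonglongrightarrow> grad i xb)"
proof -
  have subsp: "\<And>i. i < m \<Longrightarrow> subspace (V i)" and clsd: "\<And>i. i < m \<Longrightarrow> closed (V i)"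
    using V_sub by auto
  have proper: "proper_on (prodH m V) f" using f_G0 by (simp add: Gamma0_prod_def)
  define S where "S = fs_space m V"
  define D where "D = fs_dom m V f"
  define F where "F = fs_fun f"
  have S: "complete S" "subspace S"
    unfolding S_def by (rule complete_fs_space[OF subsp clsd], assumption+)
      (rule subspace_fs_space[OF subsp])
  have DS: "D \<subseteq> S" unfolding D_def S_def by (rule fs_dom_subset)
  have conv: "convex_on D F" unfolding D_def F_def by (rule convex_on_fs_fun[OF subsp f_G0])
  have clos: "closed_fun_on S D F"
    unfolding S_def D_def F_def by (rule closed_fun_on_fs_fun[OF f_G0])
  have Grad_in: "Grad m grad h \<in> prodH m V" if "h \<in> prodH m V" for h
    using grad_in[OF _ that] by (simp add: Grad_def prodH_def)
  define B where "B p = Abs_fs (Grad m grad (nth_fs p))" for p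
  have nth_B: "nth_fs (B p) = Grad m grad (nth_fs p)" if "p \<in> S" for p
    using that Grad_in nth_Abs_fs unfolding B_def S_def by (blast dest: nth_fs_mem)
  have nth_B': "nth_fs (B p) i = grad i (nth_fs p)" if "p \<in> S" "i < m" for p i
    using that by (simp add: nth_B Grad_def)
  have BS: "B p \<in> S" if "p \<in> S" for p
    using that Grad_in Abs_fs_in_fs_space unfolding B_def S_def by (blast dest: nth_fs_mem)
  have coco: "inner (B p - B q) (p - q) \<ge> (1 / chi) * (norm (B p - B q))\<^sup>2" if "p \<in> S" "q \<in> S" for p q
  proof -
    have d: "B p - B q \<in> fs_space m V"
      using subspace_diff[OF S(2) BS[OF that(1)] BS[OF that(2)]] by (simp add: S_def)
    show ?thesis
      using cocoercive[of "nth_fs p" "nth_fs q"] that nth_fs_mem[of _ m V]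
      by (simp add: power2_norm_eq_inner inner_fs_space(1)[OF d] minus_fin_seq.rep_eq nth_B' S_def[symmetric])
  qed
  have subdiff_iff: "(\<lambda>i. - Grad m grad (nth_fs p) i) \<in> subdiff_prod m V f (nth_fs p)
      \<longleftrightarrow> subgrad_on D F p (- B p)" if "p \<in> S" for p
  proof -
    have "nth_fs (- B p) = (\<lambda>i. - Grad m grad (nth_fs p) i)"
      by (simp add: fun_eq_iff uminus_fin_seq.rep_eq nth_B[OF that])
    then show ?thesis
      using subdiff_prod_iff_subgrad_on[OF proper, of p "- B p"] that subspace_neg[OF S(2) BS[OF that]]
      by (simp add: S_def D_def F_def)
  qed
  obtain h where h: "h \<in> prodH m V" "(\<lambda>i. - Grad m grad h i) \<in> subdiff_prod m V f h"
    using zero_ex by blast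
  have z: "subgrad_on D F (Abs_fs h) (- B (Abs_fs h))"
    using subdiff_iff[of "Abs_fs h"] h Abs_fs_in_fs_space[OF h(1)] by (simp add: S_def nth_Abs_fs[OF h(1)])
  have gpos: "\<gamma> n > 0" for n using gamma[of n] eps_bd(1) by linarith

  define X where "X n = Abs_fs (x n)" for n
  define A where "A n = Abs_fs (a n)" for n
  define C where "C n = Abs_fs (b n)" for n
  have A: "nth_fs (A n) = a n" "A n \<in> S" and C: "nth_fs (C n) = b n" "C n \<in> S" for n
    using nth_Abs_fs[OF a_in] nth_Abs_fs[OF b_in] Abs_fs_in_fs_space[OF a_in] Abs_fs_in_fs_space[OF b_in]
    by (auto simp: A_def C_def S_def)
  \<comment> \<open>Conditional on \<open>x n\<close> lying in the direct sum: the conclusion shows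
    that \<open>x (Suc n)\<close> lies there again, so membership for all \<open>n\<close> follows
    by induction.\<close>
  have prox: "\<exists>p. subgrad_on D F p ((1 / \<gamma> n) *\<^sub>R (X n - \<gamma> n *\<^sub>R (B (X n) + A n) - p))
      \<and> x (Suc n) = nth_fs (p + C n)" if x: "x n \<in> prodH m V" for n
  proof -
    have X: "nth_fs (X n) = x n" "X n \<in> S"
      using x by (auto simp: X_def S_def nth_Abs_fs Abs_fs_in_fs_space)
    define w where "w = X n - \<gamma> n *\<^sub>R (B (X n) + A n)"
    have wS: "w \<in> S" unfolding w_def
      by (intro subspace_diff subspace_scale subspace_add S X BS A)
    have y: "nth_fs w = y n"
    proof
      fix i
      have "a n i = 0" "x n i = 0" if "\<not> i < m" using that a_in[of n] x by (auto simp: prodH_def)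
      then show "nth_fs w i = y n i"
        by (simp add: w_def y_def minus_fin_seq.rep_eq scaleR_fin_seq.rep_eq plus_fin_seq.rep_eq
            X A nth_B[OF X(2)] Grad_def)
    qed
    have yP: "y n \<in> prodH m V" using nth_fs_mem[of w m V] wS y by (simp add: S_def)
    have "w = Abs_fs (y n)" by (simp add: nth_fs_inverse flip: y)
    obtain p where p: "subgrad_on D F p ((1 / \<gamma> n) *\<^sub>R (w - p))"
      using resolvent_exists_of_subgrad[OF S(1) DS conv clos z gpos] by blast
    have "prox_prod m V (\<lambda>q. ereal (\<gamma> n) * f q) (y n) = nth_fs p"
      by (rule prox_prod_eq_resolvent[OF subsp proper gpos yP])
        (use p in \<open>simp_all add: D_def F_def \<open>w = Abs_fs (y n)\<close>\<close>)
    then have "x (Suc n) = nth_fs (p + C n)"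
      unfolding x_step by (simp add: fun_eq_iff plus_fin_seq.rep_eq C)
    with p show ?thesis unfolding w_def by blast
  qed
  have xP: "x n \<in> prodH m V" for n
  proof (induction n)
    case (Suc n)
    then obtain p where p: "subgrad_on D F p ((1 / \<gamma> n) *\<^sub>R (X n - \<gamma> n *\<^sub>R (B (X n) + A n) - p))"
        "x (Suc n) = nth_fs (p + C n)"
      using prox by blast
    then have "p \<in> S" using DS by (auto simp: subgrad_on_def)
    then have "p + C n \<in> S" using C S(2) by (simp add: subspace_add)
    then show ?case by (simp add: p(2) S_def nth_fs_mem)
  qed (rule x0)
  have X: "nth_fs (X n) = x n" "X n \<in> S" for n
    using nth_Abs_fs[OF xP] Abs_fs_in_fs_space[OF xP] by (auto simp: X_def S_def)
  have "\<forall>n. \<exists>p. subgrad_on D F p ((1 / \<gamma> n) *\<^sub>R (X n - \<gamma> n *\<^sub>R (B (X n) + A n) - p))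
      \<and> x (Suc n) = nth_fs (p + C n)"
    using prox xP by blast
  from choice[OF this] obtain p where
    p: "\<And>n. subgrad_on D F (p n) ((1 / \<gamma> n) *\<^sub>R (X n - \<gamma> n *\<^sub>R (B (X n) + A n) - p n))"
    and step: "\<And>n. x (Suc n) = nth_fs (p n + C n)" by blast
  have X_step: "X (Suc n) = p n + C n" for n
    by (simp add: X_def step nth_fs_inverse)
  have summable_fs: "summable (\<lambda>n. norm (Q n))"
    if "\<And>n. Q n \<in> S" "\<And>i. i < m \<Longrightarrow> summable (\<lambda>n. norm (nth_fs (Q n) i))" for Q
  proof (rule summable_comparison_test)
    show "\<exists>N. \<forall>n\<ge>N. norm (norm (Q n)) \<le> (\<Sum>i<m. norm (nth_fs (Q n) i))"
      using norm_fs_space_le_sum[OF that(1)[unfolded S_def]] by simp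
    show "summable (\<lambda>n. \<Sum>i<m. norm (nth_fs (Q n) i))" using that(2) by (intro summable_sum) auto
  qed
  have sum: "summable (\<lambda>n. norm (A n))" "summable (\<lambda>n. norm (C n))"
    using summable_fs[of A] summable_fs[of C] a_sum b_sum by (auto simp: A C)
  have gam: "\<And>n. eps \<le> \<gamma> n" "\<And>n. \<gamma> n \<le> (2 - eps) / chi" using gamma by auto
  have "\<exists>xb\<in>S. subgrad_on D F xb (- B xb) \<and> (\<forall>w. (\<lambda>n. inner (X n) w) \<longlonglongrightarrow> inner xb w)
      \<and> (\<lambda>n. B (X n)) \<longlonglongrightarrow> B xb"
    by (rule forward_backward_weak_convergence[where \<gamma> = \<gamma> and x = X,
      OF S DS conv clos BS chi_pos coco z eps_bd(1) gam X(2) sum p X_step])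
  then obtain xb where xb: "xb \<in> S" "subgrad_on D F xb (- B xb)"
    and weak: "\<forall>w. (\<lambda>n. inner (X n) w) \<longlonglongrightarrow> inner xb w" and strong: "(\<lambda>n. B (X n)) \<longlonglongrightarrow> B xb"
    by (elim bexE conjE)
  define v where "v = nth_fs xb"
  have vP: "v \<in> prodH m V" using xb(1) by (simp add: v_def S_def nth_fs_mem)
  have v_sub: "(\<lambda>i. - Grad m grad v i) \<in> subdiff_prod m V f v"
    using subdiff_iff[OF xb(1)] xb(2) by (simp add: v_def)

  \<comment> \<open>Changing only coordinate \<open>i\<close> collapses the subgradient inequality
    of \<open>f\<close> to the single term \<open>- inner (grad i v) (t - v i)\<close>, which
    cancels against the gradient inequality for \<open>g i\<close>.\<close>
  have "f v + ereal (g i v) \<le> f (v(i := t)) + ereal (g i (v(i := t)))" if i: "i < m" and t: "t \<in> V i" for i t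
  proof -
    have "v(i := t) \<in> prodH m V" using vP i t by (auto simp: prodH_def)
    then have 1: "f v + ereal (pinner m (\<lambda>i. - Grad m grad v i) (psub (v(i := t)) v)) \<le> f (v(i := t))"
      using v_sub by (simp add: subdiff_prod_def)
    have "pinner m (\<lambda>i. - Grad m grad v i) (psub (v(i := t)) v)
        = (\<Sum>j<m. if j = i then - inner (grad i v) (t - v i) else 0)"
      unfolding pinner_def psub_def by (rule sum.cong) (auto simp: Grad_def)
    then have 2: "pinner m (\<lambda>i. - Grad m grad v i) (psub (v(i := t)) v) = - inner (grad i v) (t - v i)"
      using i by simp
    have 3: "g i v + inner (grad i v) (t - v i) \<le> g i (v(i := t))"
      using convex_on_above_gradient[OF g_conv[OF i vP] g_diff[OF i vP] _ t] vP i by (simp add: prodH_def)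
    have "\<bar>f v\<bar> \<noteq> \<infinity>" using v_sub by (simp add: subdiff_prod_def)
    then obtain c where c: "f v = ereal c" by auto
    show ?thesis using 1 3 unfolding 2 c by (cases "f (v(i := t))") auto
  qed
  then have "solves_P m V f g v" using vP by (simp add: solves_P_def)
  moreover have "weak_conv (\<lambda>n. x n i) (v i)" if "i < m" for i
    unfolding weak_conv_def
  proof
    fix u :: 'a
    \<comment> \<open>\<open>u\<close> may lie outside \<open>V i\<close>, so \<open>w\<close> may
      lie outside \<open>S\<close>; the weak limit was obtained against all vectors of the ambient
      space.\<close>
    define w where "w = Abs_fs (\<lambda>j. if j = i then u else 0)"
    have w: "nth_fs w = (\<lambda>j. if j = i then u else 0)"
      unfolding w_def by (rule nth_Abs_fs[of _ m "\<lambda>_. UNIV"]) (use that in \<open>auto simp: prodH_def\<close>)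
    have "inner q w = inner (nth_fs q i) u" for q
      using inner_fin_seq_superset[of "{i}" q w] by (simp add: w)
    then show "(\<lambda>n. inner (x n i) u) \<longlonglongrightarrow> inner (v i) u" using spec[OF weak, of w] by (simp add: X v_def)
  qed
  moreover have "(\<lambda>n. grad i (x n)) \<longlonglongrightarrow> grad i v" if "i < m" for i
    using tendsto_nth_fs[OF strong, of i] that by (simp add: nth_B' X xb(1) v_def)
  ultimately show ?thesis by blast
qed

end
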